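(* There is a policy $\pi$ (taking $T,K,M,G$ as inputs) which, for all integers $K,M,T\ge 1$ and every strongly observable directed graph $G=([K],E)$, satisfies $R_T(\pi;G,M)=\widetilde{O}\big(\sqrt{\min\{\overline{\beta}_M(G),\mathsf{m}(G)\}\,T}\big)$ over arbitrary context sequences, and which moreover, whenever $G$ is undirected or transitively closed, satisfies $$R_T(\pi;G,M)=\widetilde{O}\big(\sqrt{\beta_M(G)\,T}\big).$$ Here $$\beta_M(G)=\max\Big\{\sum_{c=1}^M |I_c| : I_1,\dots,I_M \text{ disjoint independent subsets of } [K],\ \text{and } I_i\not\to I_j \text{ for all } i<j\Big\},$$ $$\overline{\beta}_M(G)=\max\Big\{\sum_{c=1}^M |I_c| : I_1,\dots,I_M \text{ disjoint independent subsets of } [K]\Big\},$$ where $I_i\not\to I_j$ means that $(u,v)\notin E$ whenever $u\in I_i$ and $v\in I_j$ (the sets $I_c$ may be empty).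
   Context: Graph conventions: $[n]=\{1,\dots,n\}$. For a directed graph $G=([K],E)$ (self-loops allowed), $u\to v$ means $(u,v)\in E$. $G$ is undirected if $u\to v$ implies $v\to u$, and transitively closed if $u\to v$ and $v\to w$ imply $u\to w$. A set $I\subseteq[K]$ is independent if $(u,v)\notin E$ for all distinct $u,v\in I$. $G$ is strongly observable if for every $a\in[K]$, either $a\to a$ or $a'\to a$ for all $a'\ne a$. The maximum acyclic subgraph (MAS) number is $\mathsf{m}(G)=\max\{|D|: D\subseteq[K]$ induces an acyclic subgraph of $G\}$, where acyclic means having no directed cycle other than self-loops. Stochastic contextual bandits with graph feedback and complete cross-learning: there are $M$ contexts, $K$ actions, a horizon $T$, and a known feedback graph $G$ on the actions. An environment consists of unknown means $\mu=(\mu_{c,a})_{c\in[M],a\in[K]}\in[0,1]^{M\times K}$ and reward vectors $(r_{t,c,a})_{c\in[M],a\in[K]}$, $t\in[T]$, independent across $t$, with $r_{t,c,a}\in[0,1]$ and $\mathbb{E}[r_{t,c,a}]=\mu_{c,a}$. An oblivious adversary fixes a context sequence $c^T=(c_1,\dots,c_T)\in[M]^T$. In each round $t$, the context $c_t$ is revealed, the learner chooses an action $a_t=\pi_t(c_t)\in[K]$ (possibly at random) based on past observations and $c_t$, and then observes $r_{t,c,a}$ for all $c\in[M]$ and all $a$ with $(a_t,a)\in E$. The regret of a policy $\pi$ is $$R_T(\pi;G,M)=\sup_{c^T}\ \sup_{\mu}\ \mathbb{E}\Big[\sum_{t=1}^T\big(\max_{a\in[K]}\mu_{c_t,a}-\mu_{c_t,a_t}\big)\Big],$$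 the supremum being over all context sequences and all environments. $\widetilde{O}(\cdot)$ hides absolute constants and factors polylogarithmic in $K,M,T$. *)

theory Defs
  imports "HOL-Probability.Probability"
begin

(* A directed graph on {1..K}, self-loops allowed, is given by its edge relation
   E \<subseteq> {1..K} \<times> {1..K}; it is undirected iff sym E and transitively closed iff trans E. *)

definition strongly_observable :: "nat \<Rightarrow> (nat \<times> nat) set \<Rightarrow> bool" where
  "strongly_observable K E \<longleftrightarrow>
     (\<forall>a\<in>{1..K}. (a, a) \<in> E \<or> (\<forall>a'\<in>{1..K}. a' \<noteq> a \<longrightarrow> (a', a) \<in> E))"

definition independent_set :: "nat \<Rightarrow> (nat \<times> nat) set \<Rightarrow> nat set \<Rightarrow> bool" where
  "independent_set K E I \<longleftrightarrow>
     I \<subseteq> {1..K} \<and> (\<forall>u\<in>I. \<forall>v\<in>I. u \<noteq> v \<longrightarrow> (u, v) \<notin> E)"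

definition mas_number :: "nat \<Rightarrow> (nat \<times> nat) set \<Rightarrow> nat" where
  "mas_number K E = Max {card D | D. D \<subseteq> {1..K} \<and> acyclic (E \<inter> D \<times> D - Id)}"

definition beta_bar :: "nat \<Rightarrow> nat \<Rightarrow> (nat \<times> nat) set \<Rightarrow> nat" where
  "beta_bar M K E = Max {(\<Sum>c=1..M. card (I c)) | I.
     (\<forall>c\<in>{1..M}. independent_set K E (I c)) \<and> disjoint_family_on I {1..M}}"

definition beta :: "nat \<Rightarrow> nat \<Rightarrow> (nat \<times> nat) set \<Rightarrow> nat" where
  "beta M K E = Max {(\<Sum>c=1..M. card (I c)) | I.
     (\<forall>c\<in>{1..M}. independent_set K E (I c)) \<and> disjoint_family_on I {1..M} \<and>
     (\<forall>i\<in>{1..M}. \<forall>j\<in>{1..M}. i < j \<longrightarrow> (\<forall>u\<in>I i. \<forall>v\<in>I j. (u, v) \<notin> E))}"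


(* Contexts are {1..M}, actions are {1..K}, and the T rounds are numbered from 0 to T - 1.
   A reward realisation is r, where r t (c, a) is the reward of action a under context c
   in round t. *)

definition reward_space :: "nat \<Rightarrow> nat \<Rightarrow> (nat \<times> nat \<Rightarrow> real) measure" where
  "reward_space M K = PiM ({1..M} \<times> {1..K}) (\<lambda>_. borel)"

(* An environment is the mean table \<mu> together with the joint law P of the reward vectors of
   all rounds. The vectors need not be identically distributed, and the entries of a single
   vector may be dependent. *)
definition environments ::
  "nat \<Rightarrow> nat \<Rightarrow> nat \<Rightarrow> ((nat \<times> nat \<Rightarrow> real) \<times> (nat \<Rightarrow> nat \<times> nat \<Rightarrow> real) measure) set" where
  "environments M K T = {(\<mu>, P).
     prob_space P \<and> sets P = sets (PiM {..<T} (\<lambda>_. reward_space M K)) \<and>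
     prob_space.indep_vars P (\<lambda>_. reward_space M K) (\<lambda>t r. r t) {..<T} \<and>
     (\<forall>t<T. \<forall>c\<in>{1..M}. \<forall>a\<in>{1..K}.
        (AE r in P. r t (c, a) \<in> {0..1}) \<and> (\<integral>r. r t (c, a) \<partial>P) = \<mu> (c, a))}"

(* The triples (s, c, a) such that r s (c, a) has been observed after the actions as ! 0,
   as ! 1, ... have been played. *)
definition observed :: "nat \<Rightarrow> nat \<Rightarrow> (nat \<times> nat) set \<Rightarrow> nat list \<Rightarrow> (nat \<times> nat \<times> nat) set" where
  "observed M K E as =
     {(s, c, a). s < length as \<and> c \<in> {1..M} \<and> a \<in> {1..K} \<and> (as ! s, a) \<in> E}"

definition observation ::
  "nat \<Rightarrow> nat \<Rightarrow> (nat \<times> nat) set \<Rightarrow> nat list \<Rightarrow> (nat \<Rightarrow> nat \<times> nat \<Rightarrow> real) \<Rightarrow> (nat \<times> nat \<times> nat \<Rightarrow> real)" where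
  "observation M K E as r = restrict (\<lambda>(s, c, a). r s (c, a)) (observed M K E as)"

(* In round t the policy receives the contexts of rounds 0, ..., t (the last one being the
   current context), the t actions played so far, and the rewards observed so far; it returns
   the conditional law of the next action. *)
type_synonym policy = "nat list \<Rightarrow> nat list \<Rightarrow> (nat \<times> nat \<times> nat \<Rightarrow> real) \<Rightarrow> nat pmf"

definition is_policy :: "nat \<Rightarrow> nat \<Rightarrow> nat \<Rightarrow> (nat \<times> nat) set \<Rightarrow> policy \<Rightarrow> bool" where
  "is_policy T K M E \<pi> \<longleftrightarrow>
     (\<forall>cs as. set cs \<subseteq> {1..M} \<longrightarrow> set as \<subseteq> {1..K} \<longrightarrow> length as < T \<longrightarrow>
        length cs = Suc (length as) \<longrightarrow>
        (\<forall>\<omega>. set_pmf (\<pi> cs as \<omega>) \<subseteq> {1..K}) \<and>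
        (\<forall>a. (\<lambda>\<omega>. pmf (\<pi> cs as \<omega>) a) \<in> borel_measurable (PiM (observed M K E as) (\<lambda>_. borel))))"

(* The conditional law, given the reward realisation r, of the actions of the first t rounds
   (the learner's randomisation is independent of the rewards). *)
primrec play ::
  "nat \<Rightarrow> nat \<Rightarrow> (nat \<times> nat) set \<Rightarrow> policy \<Rightarrow> (nat \<Rightarrow> nat) \<Rightarrow> (nat \<Rightarrow> nat \<times> nat \<Rightarrow> real) \<Rightarrow>
   nat \<Rightarrow> nat list pmf" where
  "play M K E \<pi> ctx r 0 = return_pmf []"
| "play M K E \<pi> ctx r (Suc t) =
     bind_pmf (play M K E \<pi> ctx r t) (\<lambda>as.
       map_pmf (\<lambda>a. as @ [a]) (\<pi> (map ctx [0..<Suc t]) as (observation M K E as r)))"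

definition expected_regret ::
  "nat \<Rightarrow> nat \<Rightarrow> nat \<Rightarrow> (nat \<times> nat) set \<Rightarrow> policy \<Rightarrow> (nat \<Rightarrow> nat) \<Rightarrow> (nat \<times> nat \<Rightarrow> real) \<Rightarrow>
   (nat \<Rightarrow> nat \<times> nat \<Rightarrow> real) measure \<Rightarrow> real" where
  "expected_regret T K M E \<pi> ctx \<mu> P =
     (\<integral>r. measure_pmf.expectation (play M K E \<pi> ctx r T)
        (\<lambda>as. \<Sum>t<T. (MAX a\<in>{1..K}. \<mu> (ctx t, a)) - \<mu> (ctx t, as ! t)) \<partial>P)"

definition regret :: "nat \<Rightarrow> nat \<Rightarrow> nat \<Rightarrow> (nat \<times> nat) set \<Rightarrow> policy \<Rightarrow> ereal" where
  "regret T K M E \<pi> =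
     (SUP ctx \<in> {..<T} \<rightarrow>\<^sub>E {1..M}. SUP (\<mu>, P) \<in> environments M K T.
        ereal (expected_regret T K M E \<pi> ctx \<mu> P))"

end

theory Submission
  imports Defs "HOL-Library.Discrete_Functions"
begin

text \<open>The policy is deterministic arm elimination. Because of complete cross-learning, the number of
  observations of an arm does not depend on the context; call its rounded binary logarithm the
  layer of the arm. In each round the policy looks at the arms of lowest layer that the current
  context has not yet eliminated, and plays the one among those with a self-loop that observes the
  most of them. On the event that all confidence intervals are correct, a round of layer \<open>l\<close> costs at
  most \<open>O(sqrt (L / 2 ^ l))\<close>, so it remains to show that layer \<open>l\<close> has \<open>O(2 ^ l * b)\<close> rounds up
  to logarithms, for each of the graph parameters \<open>b\<close>.

  For the acyclic number this holds for every choice of a lowest arm, by Turan's theorem applied to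
  the graph on the rounds of the layer. For \<open>beta_bar\<close>, each round is charged to the arms that it
  observes; the arms charged to one context at one scale of the greedy degree span a sparse graph,
  which again contains a large independent set.\<close>

subsection \<open>Counting the rounds of a layer\<close>

text \<open>An arbitrary context order leaves no control over the edges between arms charged to
  different contexts. Charging therefore yields disjoint independent sets in no particular order,
  hence \<open>beta_bar\<close>, and the ordered number \<open>beta\<close> is reached by other
  means. If \<open>E\<close> is symmetric, an acyclic set is independent and the acyclic bound
  suffices; if \<open>E\<close> is transitive, the charged arms form a partial order that can be
  layered afresh into antichains. A self-loop is what makes playing an arm count as observing it. An
  arm without one is observed by every other arm, so rounds whose lowest arms are all loopless are
  counted separately, by an argument that costs no graph parameter. Of the two logarithmic factors
  in the final bound, one counts the layers; the other is a product of two square roots, one from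
  the scales of the degree and one from the confidence level \<open>L\<close>.\<close>

lemma exists_large_independent_subset:
  fixes R :: "('a \<times> 'a) set"
  assumes "finite V" "\<And>v. v \<in> V \<Longrightarrow> card {w \<in> V. w \<noteq> v \<and> (v, w) \<in> R} \<le> d"
  shows "\<exists>I\<subseteq>V. (\<forall>u\<in>I. \<forall>v\<in>I. u \<noteq> v \<longrightarrow> (u, v) \<notin> R) \<and> card V \<le> (2 * d + 1) * card I"
  using assms
proof (induction "card V" arbitrary: V rule: less_induct)
  case less
  show ?case
  proof (cases "V = {}")
    case False
    \<comment> \<open>In-degrees and out-degrees have the same sum, so bounded out-degrees force
      some vertex to have in-degree at most \<open>d\<close> as well. Its closed neighbourhood has
      at most \<open>2 * d + 1\<close> vertices and is deleted before recursing.\<close>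
    have "(\<Sum>v\<in>V. card {w \<in> V. w \<noteq> v \<and> (w, v) \<in> R}) = (\<Sum>v\<in>V. card {w \<in> V. w \<noteq> v \<and> (v, w) \<in> R})"
      using sum.swap_restrict[OF \<open>finite V\<close> \<open>finite V\<close>, of "\<lambda>_ _. 1::nat" "\<lambda>w v. w \<noteq> v \<and> (w, v) \<in> R"]
      by (simp add: eq_commute conj_commute)
    also have "\<dots> \<le> (\<Sum>v\<in>V. d)"
      by (intro sum_mono less.prems)
    finally have "\<not> (\<forall>v\<in>V. d < card {w \<in> V. w \<noteq> v \<and> (w, v) \<in> R})"
      using sum_strict_mono[OF \<open>finite V\<close> False, of "\<lambda>_. d" "\<lambda>v. card {w \<in> V. w \<noteq> v \<and> (w, v) \<in> R}"]
      by auto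
    then obtain v where v: "v \<in> V" "card {w \<in> V. w \<noteq> v \<and> (w, v) \<in> R} \<le> d"
      by (auto simp: not_less)
    let ?N = "insert v ({w \<in> V. w \<noteq> v \<and> (w, v) \<in> R} \<union> {w \<in> V. w \<noteq> v \<and> (v, w) \<in> R})"
    have N: "?N \<subseteq> V" "finite ?N"
      using v less.prems(1) by auto
    have "card ?N \<le> Suc (card ({w \<in> V. w \<noteq> v \<and> (w, v) \<in> R} \<union> {w \<in> V. w \<noteq> v \<and> (v, w) \<in> R}))"
      by (rule card_insert_le_m1) auto
    also have "\<dots> \<le> Suc (d + d)"
      using card_Un_le[of "{w \<in> V. w \<noteq> v \<and> (w, v) \<in> R}" "{w \<in> V. w \<noteq> v \<and> (v, w) \<in> R}"]
        v(2) less.prems(2)[OF v(1)] by linarith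
    finally have cN: "card ?N \<le> 2 * d + 1" by simp
    have "\<exists>I\<subseteq>V - ?N. (\<forall>u\<in>I. \<forall>v\<in>I. u \<noteq> v \<longrightarrow> (u, v) \<notin> R) \<and> card (V - ?N) \<le> (2 * d + 1) * card I"
    proof (rule less.hyps)
      show "card (V - ?N) < card V"
        using v less.prems(1) by (intro psubset_card_mono) auto
      fix u assume u: "u \<in> V - ?N"
      have "card {w \<in> V - ?N. w \<noteq> u \<and> (u, w) \<in> R} \<le> card {w \<in> V. w \<noteq> u \<and> (u, w) \<in> R}"
        using less.prems(1) by (intro card_mono) auto
      then show "card {w \<in> V - ?N. w \<noteq> u \<and> (u, w) \<in> R} \<le> d"
        using less.prems(2)[of u] u by (meson DiffD1 le_trans)
    qed (use less.prems in auto)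
    then obtain I where I: "I \<subseteq> V - ?N" "\<forall>u\<in>I. \<forall>v\<in>I. u \<noteq> v \<longrightarrow> (u, v) \<notin> R"
      "card (V - ?N) \<le> (2 * d + 1) * card I" by blast
    have fI: "finite I" using I(1) less.prems(1) finite_subset by fastforce
    have "card V = card (V - ?N) + card ?N"
      using card_Diff_subset[OF N(2,1)] card_mono[OF less.prems(1) N(1)] by linarith
    also have "\<dots> \<le> (2 * d + 1) * card (insert v I)"
    proof -
      have "v \<notin> I" using I(1) by auto
      then show ?thesis using I(3) cN fI by (simp add: algebra_simps)
    qed
    finally show ?thesis
      using I v by (intro exI[of _ "insert v I"]) blast
  qed simp
qed

section \<open>Greedy choice among the lowest active arms\<close>

definition in_nbrs :: "('a \<times> 'a) set \<Rightarrow> 'a \<Rightarrow> 'a set" where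
  "in_nbrs E b = {a. (a, b) \<in> E}"

definition least_level :: "('a \<Rightarrow> nat) \<Rightarrow> 'a set \<Rightarrow> 'a set" where
  "least_level lv A = {a \<in> A. \<forall>b\<in>A. lv a \<le> lv b}"

definition looped :: "('a \<times> 'a) set \<Rightarrow> 'a set \<Rightarrow> 'a set" where
  "looped E U = {a \<in> U. (a, a) \<in> E}"

text \<open>Arms with the same in-neighbourhood are always observed together, so they are counted once.
  In a transitively closed graph this identifies each strongly connected component, and it is
  what makes the greedy rule achieve \<open>beta\<close> there.\<close>

definition coverage :: "('a \<times> 'a) set \<Rightarrow> 'a set \<Rightarrow> 'a \<Rightarrow> nat" where
  "coverage E W a = card (in_nbrs E ` {b \<in> W. (a, b) \<in> E})"

text \<open>If no lowest arm has a loop, any active arm may be played, except a sole lowest arm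
  while others are active: playing it would not observe it, and its level could stay low
  forever.\<close>

definition greedy_choice :: "('a \<times> 'a) set \<Rightarrow> ('a \<Rightarrow> nat) \<Rightarrow> 'a set \<Rightarrow> 'a \<Rightarrow> bool" where
  "greedy_choice E lv A a \<longleftrightarrow> a \<in> A \<and>
     (let W = looped E (least_level lv A) in
      if W \<noteq> {} then a \<in> W \<and> (\<forall>b\<in>W. coverage E W b \<le> coverage E W a)
      else least_level lv A = {a} \<longrightarrow> A = {a})"

lemma least_level_nonempty:
  assumes "finite A" "A \<noteq> {}"
  shows "least_level lv A \<noteq> {}"
proof -
  have "Min (lv ` A) \<in> lv ` A" using assms by simp
  then obtain a where "a \<in> A" "lv a = Min (lv ` A)" by force
  then have "a \<in> least_level lv A" using assms by (simp add: least_level_def)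
  then show ?thesis by blast
qed

lemma greedy_choice_exists:
  assumes "finite A" "A \<noteq> {}"
  shows "\<exists>a. greedy_choice E lv A a"
proof (cases "looped E (least_level lv A) = {}")
  case True
  show ?thesis
  proof (cases "\<exists>a. A = {a}")
    case True then show ?thesis by (auto simp: greedy_choice_def Let_def least_level_def looped_def)
  next
    case False
    then obtain a b where "a \<in> A" "b \<in> A" "a \<noteq> b" using assms(2) by blast
    then have "\<exists>a\<in>A. least_level lv A = {a} \<longrightarrow> A = {a}" by (metis singleton_inject)
    then show ?thesis using True by (auto simp: greedy_choice_def Let_def)
  qed
next
  case False
  define W where "W = looped E (least_level lv A)"
  have "finite W" "W \<subseteq> A" using assms by (auto simp: W_def looped_def least_level_def)
  then have "Max (coverage E W ` W) \<in> coverage E W ` W" using False by (simp add: W_def)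
  then obtain a where "a \<in> W" "coverage E W a = Max (coverage E W ` W)" by force
  then have "greedy_choice E lv A a"
    using \<open>finite W\<close> \<open>W \<subseteq> A\<close> unfolding greedy_choice_def Let_def W_def[symmetric] by auto
  then show ?thesis ..
qed

text \<open>This is what the charging argument produces. Loops and distinct in-neighbourhoods go
  beyond \<open>beta_bar\<close>; they make a transitive \<open>E\<close> reflexive and
  antisymmetric on the union.\<close>

definition twin_free_family :: "nat \<Rightarrow> nat \<Rightarrow> (nat \<times> nat) set \<Rightarrow> (nat \<Rightarrow> nat set) \<Rightarrow> bool" where
  "twin_free_family M K E I \<longleftrightarrow>
     (\<forall>c\<in>{1..M}. independent_set K E (I c)) \<and> disjoint_family_on I {1..M} \<and>
     (\<forall>u\<in>(\<Union>c\<in>{1..M}. I c). (u, u) \<in> E) \<and> inj_on (in_nbrs E) (\<Union>c\<in>{1..M}. I c)"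

text \<open>The combinatorial shadow of the policy, free of rewards: \<open>x\<close> is the played
  arm, \<open>c\<close> the context and \<open>A t i\<close> the active set of context
  \<open>i\<close> before round \<open>t\<close>. The successor in \<open>lev_def\<close> puts
  unobserved arms on level 0 and gives \<open>2 ^ l\<close> \<le> n + 1 < \<open>2 ^ Suc l\<close>
  for n observations at level \<open>l\<close>.\<close>

locale elimination_run =
  fixes K M T :: nat and E :: "(nat \<times> nat) set" and x c :: "nat \<Rightarrow> nat"
    and A :: "nat \<Rightarrow> nat \<Rightarrow> nat set" and lev :: "nat \<Rightarrow> nat \<Rightarrow> nat"
  assumes edges: "E \<subseteq> {1..K} \<times> {1..K}"
    and strong: "strongly_observable K E"
    and ctx: "t < T \<Longrightarrow> c t \<in> {1..M}"
    and active_sub: "A t i \<subseteq> {1..K}"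
    and active_antimono: "s \<le> t \<Longrightarrow> A t i \<subseteq> A s i"
    and active_nonempty: "t < T \<Longrightarrow> A t (c t) \<noteq> {}"
    and lev_def: "lev t a = floor_log (Suc (card {s. s < t \<and> (x s, a) \<in> E}))"
    and greedy: "t < T \<Longrightarrow> greedy_choice E (lev t) (A t (c t)) (x t)"
begin

definition U :: "nat \<Rightarrow> nat set" where "U t = least_level (lev t) (A t (c t))"
definition W :: "nat \<Rightarrow> nat set" where "W t = looped E (U t)"

text \<open>All arms of \<open>U t\<close> share one level and \<open>U t\<close> is nonempty for
  \<open>t < T\<close>, so every such round lies in exactly one layer.\<close>

definition rounds :: "nat \<Rightarrow> nat set" where
  "rounds l = {t. t < T \<and> (\<forall>a\<in>U t. lev t a = l)}"

lemma finite_active: "finite (A t i)"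
  by (rule finite_subset[OF active_sub]) simp

lemma finite_rounds [simp]: "finite (rounds l)"
  by (rule finite_subset[of _ "{..<T}"]) (auto simp: rounds_def)

lemma U_nonempty: "t < T \<Longrightarrow> U t \<noteq> {}"
  unfolding U_def using active_nonempty finite_active by (intro least_level_nonempty) auto

lemma U_sub: "U t \<subseteq> A t (c t)"
  by (auto simp: U_def least_level_def)

lemma lev_mono: "s \<le> t \<Longrightarrow> lev s a \<le> lev t a"
  unfolding lev_def by (intro floor_log_le_iff Suc_le_mono[THEN iffD2] card_mono) auto

lemma played_in_W: "t < T \<Longrightarrow> W t \<noteq> {} \<Longrightarrow> x t \<in> W t"
  using greedy[of t] by (auto simp: greedy_choice_def Let_def W_def U_def split: if_splits)

lemma played_active: "t < T \<Longrightarrow> x t \<in> A t (c t)"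
  using greedy[of t] by (simp add: greedy_choice_def)

text \<open>Every round of \<open>B\<close> but the last is an observation of \<open>b\<close>
  already counted in its level at \<open>Max B\<close>. The last round itself is absorbed by the
  successor in \<open>lev_def\<close>.\<close>

lemma card_le_of_observed:
  assumes "finite B" "B \<noteq> {}" "\<And>s. s \<in> B \<Longrightarrow> s < Max B \<Longrightarrow> (x s, b) \<in> E" "lev (Max B) b = l"
  shows "card B \<le> 2 ^ Suc l"
proof -
  let ?S = "{s. s < Max B \<and> (x s, b) \<in> E}"
  have "B - {Max B} \<subseteq> ?S"
    using assms by (auto simp: le_less dest: Max_ge)
  then have "card (B - {Max B}) \<le> card ?S"
    by (intro card_mono) auto
  moreover have "Suc (card ?S) < 2 * 2 ^ l"
    using floor_log_exp2_gt[of "Suc (card ?S)"] assms(4) by (simp add: lev_def)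
  ultimately show ?thesis
    using assms(1,2) by simp
qed

lemma observed_loopless:
  assumes "v \<in> {1..K}" "(v, v) \<notin> E" "u \<in> {1..K}" "u \<noteq> v"
  shows "(u, v) \<in> E"
  using strong assms unfolding strongly_observable_def by blast

text \<open>All arms in the sets \<open>U t\<close> of these rounds are loopless, hence observed by
  every other arm. A single arm \<open>v\<close> taken from the last round is therefore observed
  whenever it is not played.\<close>

lemma loopless_rounds:
  "card {t \<in> rounds l. W t = {} \<and> A t (c t) \<noteq> {x t}} \<le> 2 * 2 ^ Suc l" (is "card ?B \<le> _")
proof (cases "?B = {}")
  case False
  have ex: "\<exists>v\<in>U t. v \<noteq> x t" if "t \<in> ?B" for t
  proof -
    have "t < T" using that by (simp add: rounds_def)
    then have "U t \<noteq> {x t}"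
      using that greedy[of t] by (auto simp: greedy_choice_def Let_def W_def U_def)
    then show ?thesis using U_nonempty[OF \<open>t < T\<close>] by auto
  qed
  have obs: "(x s, v) \<in> E" if "s \<in> ?B" "t \<in> ?B" "v \<in> U t" "v \<noteq> x s" for s t v
  proof (rule observed_loopless)
    show "v \<in> {1..K}" "x s \<in> {1..K}"
      using that U_sub active_sub played_active by (force simp: rounds_def)+
    show "(v, v) \<notin> E" using that by (auto simp: W_def looped_def)
  qed (use that in auto)
  have fin: "finite ?B" by simp
  have maxB: "Max ?B \<in> ?B" using False by (intro Max_in) auto
  then obtain v where v: "v \<in> U (Max ?B)" "v \<noteq> x (Max ?B)" using ex by blast
  \<comment> \<open>Rounds playing \<open>v\<close> do not observe \<open>v\<close>. For them the
    last such round supplies a second loopless arm \<open>w\<close>, different from \<open>v\<close>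
    and observed in all of them; so each half has at most \<open>2 ^ Suc l\<close> rounds.\<close>
  define B1 where "B1 = {s \<in> ?B. x s \<noteq> v}"
  define B2 where "B2 = {s \<in> ?B. x s = v}"
  have mB1: "Max ?B \<in> B1" using maxB v by (auto simp: B1_def)
  have "Max B1 = Max ?B"
    by (rule Max_eqI) (use mB1 in \<open>auto simp: B1_def intro!: Max_ge\<close>)
  then have "card B1 \<le> 2 ^ Suc l"
    using maxB v mB1
    by (intro card_le_of_observed[where b = v]) (auto simp: B1_def rounds_def intro!: obs)
  moreover have "card B2 \<le> 2 ^ Suc l"
  proof (cases "B2 = {}")
    case False
    then have "Max B2 \<in> B2" by (intro Max_in) (auto simp: B2_def)
    then obtain w where w: "w \<in> U (Max B2)" "w \<noteq> v" "Max B2 \<in> ?B"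
      using ex by (force simp: B2_def)
    show ?thesis
    proof (rule card_le_of_observed[where b = w])
      show "(x s, w) \<in> E" if "s \<in> B2" for s
        using that w by (intro obs) (auto simp: B2_def)
      show "lev (Max B2) w = l" using w by (auto simp: rounds_def)
    qed (use False in \<open>auto simp: B2_def\<close>)
  qed simp
  moreover have "card ?B \<le> card B1 + card B2"
    by (rule order_trans[OF card_mono card_Un_le]) (auto simp: B1_def B2_def)
  ultimately show ?thesis by linarith
next
  case True
  show ?thesis unfolding True by simp
qed

text \<open>Among the rounds of one layer, an edge from an earlier to a later played arm is an
  observation of the later one, so every round has few such edges into it. An independent set of
  rounds then consists of distinct arms with edges only backwards in time.\<close>

lemma looped_rounds_mas:
  "\<exists>D. D \<subseteq> {1..K} \<and> acyclic (E \<inter> D \<times> D - Id) \<and>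
       card {t \<in> rounds l. W t \<noteq> {}} \<le> (2 * 2 ^ Suc l + 1) * card D" (is "\<exists>D. _ \<and> _ \<and> card ?B \<le> _")
proof -
  \<comment> \<open>Pairs run from the later round to the earlier one, so that the out-degree of
    \<open>t\<close> counts earlier observations of \<open>x t\<close>.\<close>
  define R where "R = {(t, s). s < t \<and> (x s, x t) \<in> E}"
  have xW: "x t \<in> W t" "t < T" "lev t (x t) = l" if "t \<in> ?B" for t
    using that played_in_W[of t] by (auto simp: rounds_def W_def looped_def)
  have "\<exists>I\<subseteq>?B. (\<forall>u\<in>I. \<forall>v\<in>I. u \<noteq> v \<longrightarrow> (u, v) \<notin> R) \<and> card ?B \<le> (2 * 2 ^ Suc l + 1) * card I"
  proof (rule exists_large_independent_subset)
    fix t assume t: "t \<in> ?B"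
    have "card {w \<in> ?B. w \<noteq> t \<and> (t, w) \<in> R} \<le> card {s. s < t \<and> (x s, x t) \<in> E}"
      by (intro card_mono) (auto simp: R_def)
    also have "\<dots> \<le> 2 ^ Suc l"
      using floor_log_exp2_gt[of "Suc (card {s. s < t \<and> (x s, x t) \<in> E})"] xW(3)[OF t]
      by (simp add: lev_def)
    finally show "card {w \<in> ?B. w \<noteq> t \<and> (t, w) \<in> R} \<le> 2 ^ Suc l" .
  qed simp
  then obtain I where I: "I \<subseteq> ?B" "\<forall>u\<in>I. \<forall>v\<in>I. u \<noteq> v \<longrightarrow> (u, v) \<notin> R"
    "card ?B \<le> (2 * 2 ^ Suc l + 1) * card I" by blast
  have forw: "(x s, x t) \<notin> E" if "s \<in> I" "t \<in> I" "s < t" for s t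
    using I(2) that unfolding R_def by force
  have loop: "(x t, x t) \<in> E" if "t \<in> I" for t
    using xW(1)[of t] I(1) that by (auto simp: W_def looped_def)
  \<comment> \<open>A repeated arm would, through its loop, give an edge from the earlier round to
    the later one.\<close>
  have inj: "inj_on x I"
    by (rule inj_onI) (metis forw loop linorder_neqE_nat)
  have "acyclic (E \<inter> (x ` I) \<times> (x ` I) - Id)"
  proof (rule acyclic_subset)
    show "acyclic ((inv_image less_than (inv_into I x))\<inverse>)"
      by (intro acyclic_converse[THEN iffD2] wf_acyclic wf_inv_image wf_less_than)
    show "E \<inter> (x ` I) \<times> (x ` I) - Id \<subseteq> (inv_image less_than (inv_into I x))\<inverse>"
    proof (rule subsetI)
      fix e assume "e \<in> E \<inter> (x ` I) \<times> (x ` I) - Id"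
      then obtain s t where st: "(x s, x t) \<in> E" "s \<in> I" "t \<in> I" "x s \<noteq> x t" "e = (x s, x t)"
        by auto
      then have "t < s" using forw[of s t] by (metis linorder_neqE_nat)
      then show "e \<in> (inv_image less_than (inv_into I x))\<inverse>"
        using st inj by simp
    qed
  qed
  moreover have "x ` I \<subseteq> {1..K}"
    using xW(1) I(1) U_sub active_sub unfolding W_def looped_def by blast
  ultimately show ?thesis
    using I(3) card_image[OF inj] by (intro exI[of _ "x ` I"]) simp
qed

text \<open>Fix the dyadic scale \<open>2 ^ j\<close> of the coverage. All vertices charged to one context lie in the
  looped under-observed set of the first such round of that context, where no vertex has
  coverage \<open>2 * 2 ^ j\<close> or more; hence they contain an independent set of proportion \<open>2 ^ - j\<close>.\<close>

lemma looped_rounds_scale: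
  "\<exists>I. twin_free_family M K E I \<and>
     card {t \<in> rounds l. W t \<noteq> {} \<and> floor_log (coverage E (W t) (x t)) = j}
       \<le> 5 * 2 ^ Suc l * (\<Sum>i=1..M. card (I i))"
proof -
  define S where "S = {t \<in> rounds l. W t \<noteq> {} \<and> floor_log (coverage E (W t) (x t)) = j}"
  \<comment> \<open>\<open>Q t\<close> consists of the twin classes observed in round
    \<open>t\<close>, each represented by its common in-neighbourhood.\<close>
  define Q where "Q = (\<lambda>t. in_nbrs E ` {b \<in> W t. (x t, b) \<in> E})"
  have finS: "finite S" by (simp add: S_def)
  have S: "t < T" "x t \<in> W t" "t \<in> rounds l" if "t \<in> S" for t
    using that played_in_W[of t] by (auto simp: S_def rounds_def)
  have finW: "finite (W t)" for t
    using finite_active[of t "c t"] U_sub[of t] by (auto simp: W_def looped_def intro: finite_subset)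
  have finQ: "finite (Q t)" for t using finW[of t] by (simp add: Q_def)
  have cQ: "card (Q t) = coverage E (W t) (x t)" for t by (simp add: Q_def coverage_def)
  have Qne: "Q t \<noteq> {}" if "t \<in> S" for t
    using S(2)[OF that] by (auto simp: Q_def W_def looped_def)
  have scale: "2 ^ j \<le> card (Q t)" "card (Q t) < 2 * 2 ^ j" if "t \<in> S" for t
  proof -
    have j: "floor_log (card (Q t)) = j" using that by (simp add: cQ S_def)
    have "card (Q t) > 0" using Qne[OF that] finQ by (simp add: card_gt_0_iff)
    then show "2 ^ j \<le> card (Q t)" using floor_log_exp2_le[of "card (Q t)"] j by simp
    show "card (Q t) < 2 * 2 ^ j" using floor_log_exp2_gt[of "card (Q t)"] j by simp
  qed
  define QQ where "QQ = (\<Union>t\<in>S. Q t)"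
  have finQQ: "finite QQ" by (simp add: QQ_def finS finQ)
  \<comment> \<open>Double counting of pairs of a round and a class that it observes: a round has at
    least \<open>2 ^ j\<close> classes, a class at most \<open>2 ^ Suc l\<close> rounds.\<close>
  have "2 ^ j * card S \<le> (\<Sum>t\<in>S. card (Q t))"
    using sum_mono[of S "\<lambda>_. 2 ^ j" "\<lambda>t. card (Q t)"] scale(1) by (simp add: mult.commute)
  also have "\<dots> = (\<Sum>t\<in>S. \<Sum>q\<in>{q \<in> QQ. q \<in> Q t}. 1)"
    by (intro sum.cong refl) (auto simp: QQ_def intro!: arg_cong[where f = card])
  also have "\<dots> = (\<Sum>q\<in>QQ. \<Sum>t\<in>{t \<in> S. q \<in> Q t}. 1)"
    by (rule sum.swap_restrict[OF finS finQQ])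
  also have "\<dots> \<le> (\<Sum>q\<in>QQ. 2 ^ Suc l)"
  proof (rule sum_mono)
    fix q assume "q \<in> QQ"
    let ?C = "{t \<in> S. q \<in> Q t}"
    have ne: "?C \<noteq> {}" using \<open>q \<in> QQ\<close> by (auto simp: QQ_def)
    have "Max ?C \<in> ?C" using finS ne by (intro Max_in) auto
    then obtain b where b: "b \<in> W (Max ?C)" "q = in_nbrs E b" "Max ?C \<in> S" by (auto simp: Q_def)
    \<comment> \<open>Rounds of \<open>?C\<close> may have seen different members of the class, but
      \<open>x s\<close> lies in the common in-neighbourhood \<open>q\<close>, so each of them
      observes \<open>b\<close> too.\<close>
    have "card ?C \<le> 2 ^ Suc l"
    proof (rule card_le_of_observed[where b = b])
      fix s assume "s \<in> ?C"
      then show "(x s, b) \<in> E" using b(2) by (force simp: Q_def in_nbrs_def)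
    next
      show "lev (Max ?C) b = l"
        using b S(3) by (auto simp: W_def looped_def rounds_def)
    qed (use finS ne in auto)
    then show "(\<Sum>t\<in>?C. 1) \<le> (2::nat) ^ Suc l" by simp
  qed
  finally have count: "2 ^ j * card S \<le> 2 ^ Suc l * card QQ" by (simp add: mult.commute)

  have "\<forall>q\<in>QQ. \<exists>t b. t \<in> S \<and> b \<in> W t \<and> in_nbrs E b = q"
    by (auto simp: QQ_def Q_def)
  then obtain tm vx where ch: "\<And>q. q \<in> QQ \<Longrightarrow> tm q \<in> S \<and> vx q \<in> W (tm q) \<and> in_nbrs E (vx q) = q"
    by metis
  \<comment> \<open>Each class is charged to one context only, that of its chosen round
    \<open>tm q\<close>; this makes the sets \<open>V i\<close> disjoint.\<close>
  define V where "V = (\<lambda>i. vx ` {q \<in> QQ. c (tm q) = i})"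
  have injvx: "inj_on vx QQ" by (rule inj_onI) (metis ch)
  have finV: "finite (V i)" for i by (simp add: V_def finQQ)
  have VV: "(\<Union>i\<in>{1..M}. V i) \<subseteq> vx ` QQ" by (auto simp: V_def)
  have injV: "inj_on (in_nbrs E) (vx ` QQ)"
    by (rule inj_onI) (metis ch imageE)
  have Vprop: "(v, v) \<in> E" "v \<in> {1..K}" if "v \<in> vx ` QQ" for v
    using that ch U_sub active_sub unfolding W_def looped_def by blast+
  have "\<exists>I\<subseteq>V i. (\<forall>u\<in>I. \<forall>v\<in>I. u \<noteq> v \<longrightarrow> (u, v) \<notin> E) \<and> card (V i) \<le> (2 * (2 * 2 ^ j) + 1) * card I" for i
  proof (rule exists_large_independent_subset[OF finV])
    fix v assume v: "v \<in> V i"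
    let ?C = "{t \<in> S. c t = i}"
    have "?C \<noteq> {}" using v ch by (auto simp: V_def)
    then have t0: "Min ?C \<in> ?C" using finS by (intro Min_in) auto
    define t0 where "t0 = Min ?C"
    have t0S: "t0 \<in> S" "c t0 = i" using t0 by (auto simp: t0_def)
    \<comment> \<open>An arm active for \<open>i\<close> at a later round was active at
      \<open>t0\<close>. Its level there is at most \<open>l\<close> because levels only grow, and
      at least \<open>l\<close> because \<open>l\<close> is the lowest level of an active arm at
      \<open>t0\<close>.\<close>
    have VW: "V i \<subseteq> W t0"
    proof
      fix b assume "b \<in> V i"
      then obtain q where q: "q \<in> QQ" "b = vx q" "c (tm q) = i" by (auto simp: V_def)
      have tmS: "tm q \<in> S" and b: "b \<in> W (tm q)" using ch q by auto
      have le: "t0 \<le> tm q" unfolding t0_def using tmS q finS by (intro Min_le) auto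
      have bA: "b \<in> A t0 i"
        using b U_sub[of "tm q"] active_antimono[OF le, of i] q(3) by (auto simp: W_def looped_def)
      have levb: "lev t0 b \<le> l"
        using b S(3)[OF tmS] lev_mono[OF le, of b] by (auto simp: W_def looped_def rounds_def)
      obtain u where u: "u \<in> U t0" using U_nonempty S(1)[OF t0S(1)] by blast
      then have "lev t0 u = l" using S(3)[OF t0S(1)] by (auto simp: rounds_def)
      then have "\<forall>a\<in>A t0 i. l \<le> lev t0 a" using u t0S(2) by (auto simp: U_def least_level_def)
      then have "b \<in> U t0" using bA levb t0S(2) by (force simp: U_def least_level_def)
      then show "b \<in> W t0" using b by (auto simp: W_def looped_def)
    qed
    \<comment> \<open>\<open>V i\<close> has one arm per class, so counting classes counts its
      out-neighbours exactly, and \<open>coverage\<close> at \<open>t0\<close> is maximised by the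
      played arm.\<close>
    have "card {w \<in> V i. w \<noteq> v \<and> (v, w) \<in> E} = card (in_nbrs E ` {w \<in> V i. w \<noteq> v \<and> (v, w) \<in> E})"
      by (intro card_image[symmetric] inj_on_subset[OF injV]) (auto simp: V_def)
    also have "\<dots> \<le> coverage E (W t0) v"
      unfolding coverage_def using VW finW by (intro card_mono) auto
    also have "\<dots> \<le> card (Q t0)"
      using greedy[OF S(1)[OF t0S(1)]] VW v S(2)[OF t0S(1)]
      by (auto simp: greedy_choice_def Let_def cQ W_def U_def split: if_splits)
    also have "\<dots> \<le> 2 * 2 ^ j" using scale(2)[OF t0S(1)] by simp
    finally show "card {w \<in> V i. w \<noteq> v \<and> (v, w) \<in> E} \<le> 2 * 2 ^ j" .
  qed
  then obtain I where I: "\<And>i. I i \<subseteq> V i" "\<And>i. \<forall>u\<in>I i. \<forall>v\<in>I i. u \<noteq> v \<longrightarrow> (u, v) \<notin> E"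
    "\<And>i. card (V i) \<le> (2 * (2 * 2 ^ j) + 1) * card (I i)" by metis
  have IV: "I i \<subseteq> vx ` QQ" for i using I(1)[of i] by (auto simp: V_def)
  have "disjoint_family_on V {1..M}"
    using injvx by (auto simp: disjoint_family_on_def V_def inj_on_def)
  then have "disjoint_family_on I {1..M}"
    using I(1) unfolding disjoint_family_on_def by blast
  moreover have "independent_set K E (I i)" for i
    using I(2)[of i] IV[of i] Vprop(2) by (auto simp: independent_set_def)
  moreover have "inj_on (in_nbrs E) (\<Union>i\<in>{1..M}. I i)"
    using IV by (intro inj_on_subset[OF injV]) auto
  ultimately have fam: "twin_free_family M K E I"
    unfolding twin_free_family_def using IV Vprop(1) by blast
  have "QQ = (\<Union>i\<in>{1..M}. {q \<in> QQ. c (tm q) = i})"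
    using ch ctx S(1) by blast
  then have "card QQ \<le> (\<Sum>i=1..M. card {q \<in> QQ. c (tm q) = i})"
    by (metis card_UN_le finite_atLeastAtMost)
  also have "\<dots> = (\<Sum>i=1..M. card (V i))"
    unfolding V_def by (intro sum.cong refl card_image[symmetric] inj_on_subset[OF injvx]) auto
  also have "\<dots> \<le> (\<Sum>i=1..M. 5 * 2 ^ j * card (I i))"
  proof (rule sum_mono)
    fix i
    have "(2 * (2 * 2 ^ j) + 1) * card (I i) \<le> 5 * 2 ^ j * card (I i)" by (intro mult_right_mono) auto
    then show "card (V i) \<le> 5 * 2 ^ j * card (I i)" using I(3)[of i] by linarith
  qed
  finally have "card QQ \<le> 5 * 2 ^ j * (\<Sum>i=1..M. card (I i))"
    by (simp add: sum_distrib_left)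
  \<comment> \<open>The factor \<open>2 ^ j\<close> lost in extracting independent sets is the one
    gained in the double count, so it cancels.\<close>
  then have "2 ^ Suc l * card QQ \<le> 2 ^ Suc l * (5 * 2 ^ j * (\<Sum>i=1..M. card (I i)))"
    by (rule mult_le_mono2)
  also have "\<dots> = 2 ^ j * (5 * 2 ^ Suc l * (\<Sum>i=1..M. card (I i)))"
    by (simp only: ac_simps)
  finally have "2 ^ j * card S \<le> 2 ^ j * (5 * 2 ^ Suc l * (\<Sum>i=1..M. card (I i)))"
    using count by linarith
  then have "card S \<le> 5 * 2 ^ Suc l * (\<Sum>i=1..M. card (I i))" by simp
  then show ?thesis using fam S_def by blast
qed

text \<open>Coverages are at most \<open>K\<close>, so summing over dyadic scales costs only a
  logarithm. The bound \<open>b\<close> is left open to serve both \<open>beta_bar\<close> and, for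
  transitive \<open>E\<close>, \<open>beta\<close>.\<close>

lemma looped_rounds_family:
  assumes bound: "\<And>I. twin_free_family M K E I \<Longrightarrow> (\<Sum>i=1..M. card (I i)) \<le> b"
  shows "card {t \<in> rounds l. W t \<noteq> {}} \<le> Suc (floor_log K) * (5 * 2 ^ Suc l * b)" (is "card ?B \<le> _")
proof -
  let ?C = "\<lambda>j. {t \<in> rounds l. W t \<noteq> {} \<and> floor_log (coverage E (W t) (x t)) = j}"
  have "coverage E (W t) (x t) \<le> K" for t
  proof -
    have "{b \<in> W t. (x t, b) \<in> E} \<subseteq> {1..K}" using edges by auto
    then have "card (in_nbrs E ` {b \<in> W t. (x t, b) \<in> E}) \<le> card (in_nbrs E ` {1..K})"
      by (intro card_mono) auto
    also have "\<dots> \<le> K" using card_image_le[of "{1..K}" "in_nbrs E"] by simp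
    finally show ?thesis by (simp add: coverage_def)
  qed
  then have "?B \<subseteq> (\<Union>j\<in>{..floor_log K}. ?C j)"
    by (auto intro: floor_log_le_iff)
  then have "card ?B \<le> card (\<Union>j\<in>{..floor_log K}. ?C j)"
    by (intro card_mono) auto
  also have "\<dots> \<le> (\<Sum>j\<le>floor_log K. card (?C j))"
    by (rule card_UN_le) simp
  also have "\<dots> \<le> (\<Sum>j\<le>floor_log K. 5 * 2 ^ Suc l * b)"
  proof (rule sum_mono)
    fix j
    obtain I where I: "twin_free_family M K E I" "card (?C j) \<le> 5 * 2 ^ Suc l * (\<Sum>i=1..M. card (I i))"
      using looped_rounds_scale by blast
    have "5 * 2 ^ Suc l * (\<Sum>i=1..M. card (I i)) \<le> 5 * 2 ^ Suc l * b"
      using bound[OF I(1)] by (rule mult_le_mono2)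
    then show "card (?C j) \<le> 5 * 2 ^ Suc l * b" using I(2) by linarith
  qed
  finally show ?thesis by simp
qed

end

subsection \<open>The graph parameters\<close>

lemma sum_card_disjoint_le:
  fixes M :: nat
  assumes "\<forall>c\<in>{1..M}. independent_set K E (I c)" "disjoint_family_on I {1..M}"
  shows "(\<Sum>c=1..M. card (I c)) = card (\<Union>c\<in>{1..M}. I c)" "(\<Sum>c=1..M. card (I c)) \<le> K"
proof -
  have sub: "I c \<subseteq> {1..K}" if "c \<in> {1..M}" for c
    using assms(1) that by (auto simp: independent_set_def)
  show eq: "(\<Sum>c=1..M. card (I c)) = card (\<Union>c\<in>{1..M}. I c)"
    by (rule card_UN_disjoint'[symmetric]) (use assms(2) sub in \<open>auto intro: finite_subset\<close>)
  have "card (\<Union>c\<in>{1..M}. I c) \<le> card {1..K}"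
    using sub by (intro card_mono) blast+
  then show "(\<Sum>c=1..M. card (I c)) \<le> K" using eq by simp
qed

lemma finite_beta_bar_set:
  fixes M :: nat
  shows "finite {(\<Sum>c=1..M. card (I c)) | I.
     (\<forall>c\<in>{1..M}. independent_set K E (I c)) \<and> disjoint_family_on I {1..M}}"
proof (rule finite_subset)
  show "{(\<Sum>c=1..M. card (I c)) | I.
     (\<forall>c\<in>{1..M}. independent_set K E (I c)) \<and> disjoint_family_on I {1..M}} \<subseteq> {..K}"
    using sum_card_disjoint_le(2) by blast
qed simp

lemma finite_beta_set:
  fixes M :: nat
  shows "finite {(\<Sum>c=1..M. card (I c)) | I.
     (\<forall>c\<in>{1..M}. independent_set K E (I c)) \<and> disjoint_family_on I {1..M} \<and>
     (\<forall>i\<in>{1..M}. \<forall>j\<in>{1..M}. i < j \<longrightarrow> (\<forall>u\<in>I i. \<forall>v\<in>I j. (u, v) \<notin> E))}"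
  by (rule finite_subset[OF Collect_mono finite_beta_bar_set[of M K E]])
    (intro impI, elim exE conjE, intro exI conjI; assumption)

lemma le_beta_bar:
  assumes "\<forall>c\<in>{1..M}. independent_set K E (I c)" "disjoint_family_on I {1..M}"
  shows "(\<Sum>c=1..M. card (I c)) \<le> beta_bar M K E"
  unfolding beta_bar_def
  by (intro Max_ge[OF finite_beta_bar_set] CollectI exI[of _ I] conjI refl assms)

lemma le_beta:
  assumes "\<forall>c\<in>{1..M}. independent_set K E (I c)" "disjoint_family_on I {1..M}"
    "\<forall>i\<in>{1..M}. \<forall>j\<in>{1..M}. i < j \<longrightarrow> (\<forall>u\<in>I i. \<forall>v\<in>I j. (u, v) \<notin> E)"
  shows "(\<Sum>c=1..M. card (I c)) \<le> beta M K E"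
  unfolding beta_def
  by (intro Max_ge[OF finite_beta_set] CollectI exI[of _ I] conjI refl assms)

lemma finite_mas_set:
  fixes E :: "(nat \<times> nat) set"
  shows "finite {card D | D. D \<subseteq> {1..K} \<and> acyclic (E \<inter> D \<times> D - Id)}"
  by (rule finite_subset[of _ "card ` Pow {1..K}"]) auto

lemma le_mas_number:
  "D \<subseteq> {1..K} \<Longrightarrow> acyclic (E \<inter> D \<times> D - Id) \<Longrightarrow> card D \<le> mas_number K E"
  unfolding mas_number_def by (intro Max_ge[OF finite_mas_set]) blast

lemma independent_le_beta:
  assumes "independent_set K E D" "M \<ge> 1"
  shows "card D \<le> beta M K E"
proof -
  let ?I = "\<lambda>c::nat. if c = 1 then D else {}"
  have "(\<Sum>c=1..M. card (?I c)) \<le> beta M K E"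
    by (rule le_beta) (use assms in \<open>auto simp: independent_set_def disjoint_family_on_def\<close>)
  moreover have "(\<Sum>c=1..M. card (?I c)) = (\<Sum>c=1..M. if c = 1 then card D else 0)"
    by (intro sum.cong) auto
  ultimately show ?thesis using assms(2) by simp
qed

lemma beta_le_beta_bar: "beta M K E \<le> beta_bar M K E"
  unfolding beta_def beta_bar_def
proof (rule Max_mono[OF _ _ finite_beta_bar_set])
  have "0 \<in> {(\<Sum>c=1..M. card (I c)) | I.
     (\<forall>c\<in>{1..M}. independent_set K E (I c)) \<and> disjoint_family_on I {1..M} \<and>
     (\<forall>i\<in>{1..M}. \<forall>j\<in>{1..M}. i < j \<longrightarrow> (\<forall>u\<in>I i. \<forall>v\<in>I j. (u, v) \<notin> E))}"
    by (intro CollectI exI[of _ "\<lambda>_. {}"]) (simp add: independent_set_def disjoint_family_on_def)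
  then show "{(\<Sum>c=1..M. card (I c)) | I.
     (\<forall>c\<in>{1..M}. independent_set K E (I c)) \<and> disjoint_family_on I {1..M} \<and>
     (\<forall>i\<in>{1..M}. \<forall>j\<in>{1..M}. i < j \<longrightarrow> (\<forall>u\<in>I i. \<forall>v\<in>I j. (u, v) \<notin> E))} \<noteq> {}"
    by (intro notI) (drule equals0D, erule notE)
next
  show "{(\<Sum>c=1..M. card (I c)) | I.
     (\<forall>c\<in>{1..M}. independent_set K E (I c)) \<and> disjoint_family_on I {1..M} \<and>
     (\<forall>i\<in>{1..M}. \<forall>j\<in>{1..M}. i < j \<longrightarrow> (\<forall>u\<in>I i. \<forall>v\<in>I j. (u, v) \<notin> E))} \<subseteq>
   {(\<Sum>c=1..M. card (I c)) | I.
     (\<forall>c\<in>{1..M}. independent_set K E (I c)) \<and> disjoint_family_on I {1..M}}"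
    by (rule Collect_mono) (intro impI, elim exE conjE, intro exI conjI; assumption)
qed

lemma beta_pos: "K \<ge> 1 \<Longrightarrow> M \<ge> 1 \<Longrightarrow> beta M K E \<ge> 1"
  using independent_le_beta[of K E "{1}" M] by (simp add: independent_set_def)

lemma mas_pos: "K \<ge> 1 \<Longrightarrow> mas_number K E \<ge> 1"
proof -
  assume "K \<ge> 1"
  have "E \<inter> {1} \<times> {1} - Id = {}" by auto
  then have "acyclic (E \<inter> {1} \<times> {1} - Id)" by (simp only:) (simp add: acyclic_def)
  then have "card {1::nat} \<le> mas_number K E"
    using \<open>K \<ge> 1\<close> by (intro le_mas_number) auto
  then show ?thesis by simp
qed

text \<open>An edge of an undirected graph between distinct vertices of \<open>D\<close> is already
  a 2-cycle.\<close>

lemma mas_le_beta_sym: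
  assumes "sym E" "D \<subseteq> {1..K}" "acyclic (E \<inter> D \<times> D - Id)" "M \<ge> 1"
  shows "card D \<le> beta M K E"
proof (rule independent_le_beta[OF _ assms(4)])
  have "(u, v) \<notin> E" if "u \<in> D" "v \<in> D" "u \<noteq> v" for u v
  proof
    assume "(u, v) \<in> E"
    then have "(u, v) \<in> E \<inter> D \<times> D - Id" "(v, u) \<in> E \<inter> D \<times> D - Id"
      using assms(1) that by (auto dest: symD)
    then have "(u, u) \<in> (E \<inter> D \<times> D - Id)\<^sup>+" by (rule trancl_into_trancl[OF r_into_trancl])
    then show False using assms(3) by (simp add: acyclic_def)
  qed
  then show "independent_set K E D" using assms(2) by (auto simp: independent_set_def)
qed

text \<open>Twin-freeness makes \<open>E\<close> a partial order on the union \<open>D\<close> of the family, and each chain of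
  \<open>D\<close> meets every member at most once. Layering \<open>D\<close> by the length of the longest chain above a
  vertex gives at most \<open>M\<close> antichains in an order compatible with \<open>E\<close>.\<close>

lemma twin_free_family_le_beta_trans:
  assumes "trans E" "twin_free_family M K E I"
  shows "(\<Sum>c=1..M. card (I c)) \<le> beta M K E"
proof -
  define D where "D = (\<Union>c\<in>{1..M}. I c)"
  have ind: "\<forall>c\<in>{1..M}. independent_set K E (I c)" and dis: "disjoint_family_on I {1..M}"
    and loop: "\<And>u. u \<in> D \<Longrightarrow> (u, u) \<in> E" and inj: "inj_on (in_nbrs E) D"
    using assms(2) by (auto simp: twin_free_family_def D_def)
  have DK: "D \<subseteq> {1..K}" using ind by (auto simp: D_def independent_set_def)
  then have finD: "finite D" by (rule finite_subset) simp
  \<comment> \<open>Under transitivity, mutually adjacent vertices have the same in-neighbourhood,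
    which twin-freeness forbids for distinct ones.\<close>
  have anti: "u = v" if "(u, v) \<in> E" "(v, u) \<in> E" "u \<in> D" "v \<in> D" for u v
  proof -
    have "in_nbrs E u = in_nbrs E v"
      unfolding in_nbrs_def using transD[OF assms(1)] that(1,2) by blast
    then show ?thesis using inj that by (auto dest: inj_onD)
  qed
  define chain where "chain = (\<lambda>v C. C \<subseteq> D \<and> v \<in> C \<and> (\<forall>w\<in>C. (v, w) \<in> E) \<and>
     (\<forall>u\<in>C. \<forall>w\<in>C. (u, w) \<in> E \<or> (w, u) \<in> E))"
  have chain_le: "card C \<le> M" if "chain v C" for v C
  proof -
    have "\<forall>w\<in>C. \<exists>i. i \<in> {1..M} \<and> w \<in> I i" using that unfolding chain_def D_def by blast
    then obtain i where i: "\<And>w. w \<in> C \<Longrightarrow> i w \<in> {1..M} \<and> w \<in> I (i w)" by metis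
    have "inj_on i C"
    proof (rule inj_onI, rule ccontr)
      fix u w assume uw: "u \<in> C" "w \<in> C" "i u = i w" "u \<noteq> w"
      then have "(u, w) \<in> E \<or> (w, u) \<in> E" using that by (auto simp: chain_def)
      moreover have "u \<in> I (i u)" "w \<in> I (i u)" "i u \<in> {1..M}"
        using i[OF uw(1)] i[OF uw(2)] uw(3) by simp_all
      ultimately show False using ind uw by (auto simp: independent_set_def)
    qed
    then have "card C \<le> card {1..M}"
      using i by (intro card_inj_on_le) auto
    then show ?thesis by simp
  qed
  have finch: "finite (card ` {C. chain v C})" for v
    by (rule finite_subset[of _ "{..M}"]) (auto dest: chain_le)
  have single: "chain v {v}" if "v \<in> D" for v
    using that loop by (auto simp: chain_def)
  define h where "h = (\<lambda>v. Max (card ` {C. chain v C}))"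
  have h_ge: "card C \<le> h v" if "chain v C" for v C
    unfolding h_def using finch that by (intro Max_ge) auto
  have h_ex: "\<exists>C. chain v C \<and> h v = card C" if "v \<in> D" for v
    using Max_in[OF finch, of v] single[OF that] by (auto simp: h_def)
  have h_range: "h v \<in> {1..M}" if "v \<in> D" for v
    using h_ge[OF single[OF that]] h_ex[OF that] chain_le by fastforce
  \<comment> \<open>\<open>h v\<close> is the largest size of a chain starting at \<open>v\<close>.
    Prefixing \<open>u\<close> to such a chain lengthens it, since \<open>u\<close> cannot already
    occur in it by antisymmetry.\<close>
  have h_less: "h v < h u" if "(u, v) \<in> E" "u \<in> D" "v \<in> D" "u \<noteq> v" for u v
  proof -
    obtain C where C: "chain v C" "h v = card C" using h_ex[OF \<open>v \<in> D\<close>] by blast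
    have uC: "(u, w) \<in> E" if "w \<in> C" for w
    proof (rule transD[OF assms(1) \<open>(u, v) \<in> E\<close>])
      show "(v, w) \<in> E" using C(1) that by (simp add: chain_def)
    qed
    have "u \<notin> C" using anti[of u v] that C(1) by (auto simp: chain_def)
    moreover have "chain u (insert u C)"
      using C(1) that uC loop by (auto simp: chain_def)
    moreover have "finite C" using C(1) finD by (auto simp: chain_def intro: finite_subset)
    ultimately show ?thesis using h_ge[of u "insert u C"] C(2) by simp
  qed
  define J where "J = (\<lambda>i. {v \<in> D. h v = i})"
  have J_ind: "\<forall>i\<in>{1..M}. independent_set K E (J i)"
    using DK h_less by (fastforce simp: J_def independent_set_def)
  have J_dis: "disjoint_family_on J {1..M}"
    by (auto simp: disjoint_family_on_def J_def)
  \<comment> \<open>Edges between distinct vertices strictly lower \<open>h\<close>, so none leads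
    from a smaller index to a larger one, as \<open>beta\<close> demands.\<close>
  have "(\<Sum>i=1..M. card (J i)) \<le> beta M K E"
  proof (rule le_beta[OF J_ind J_dis], intro ballI impI)
    fix i j u v assume "i < j" "u \<in> J i" "v \<in> J j"
    then show "(u, v) \<notin> E" using h_less[of u v] by (auto simp: J_def)
  qed
  moreover have "(\<Union>i\<in>{1..M}. J i) = D" using h_range by (auto simp: J_def)
  ultimately show ?thesis
    using sum_card_disjoint_le(1)[OF ind dis] sum_card_disjoint_le(1)[OF J_ind J_dis] D_def by simp
qed

section \<open>Costly rounds in terms of the graph parameters\<close>

context elimination_run
begin

text \<open>A sole active arm may be loopless and then be played forever unobserved. Such rounds are
  left out because they cost nothing when all confidence intervals are correct: the sole survivor is
  optimal.\<close>

definition costly :: "nat \<Rightarrow> nat set" where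
  "costly l = {t \<in> rounds l. A t (c t) \<noteq> {x t}}"

lemma card_costly_le:
  assumes "K \<ge> 1" "M \<ge> 1"
  shows "card (costly l) \<le> 14 * Suc (floor_log K) * 2 ^ l * min (beta_bar M K E) (mas_number K E)"
    and "sym E \<or> trans E \<Longrightarrow> card (costly l) \<le> 14 * Suc (floor_log K) * 2 ^ l * beta M K E"
proof -
  \<comment> \<open>The constant 14 is 4 from the loopless rounds plus 10 from the looped ones;
    \<open>b \<ge> 1\<close> allows the former to be multiplied by \<open>b\<close>.\<close>
  have main: "card (costly l) \<le> 14 * Suc (floor_log K) * 2 ^ l * b"
    if "b \<ge> 1" "card {t \<in> rounds l. W t \<noteq> {}} \<le> Suc (floor_log K) * (5 * 2 ^ Suc l * b)" for b
  proof -
    let ?L = "{t \<in> rounds l. W t = {} \<and> A t (c t) \<noteq> {x t}}" and ?B = "{t \<in> rounds l. W t \<noteq> {}}"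
    have "card (costly l) \<le> card ?L + card ?B"
      by (rule order_trans[OF card_mono card_Un_le]) (auto simp: costly_def)
    also have "\<dots> \<le> 4 * 2 ^ l + Suc (floor_log K) * (10 * 2 ^ l * b)"
      using loopless_rounds[of l] that(2) by simp
    also have "4 * 2 ^ l \<le> Suc (floor_log K) * (4 * 2 ^ l * b)"
      using mult_le_mono[of 1 "Suc (floor_log K)" "4 * 2 ^ l * 1" "4 * 2 ^ l * b"] that(1) by simp
    finally show ?thesis by (simp add: algebra_simps)
  qed
  \<comment> \<open>The acyclic bound is weakened by a logarithm to share the shape of the charging
    bound.\<close>
  have mas: "card {t \<in> rounds l. W t \<noteq> {}} \<le> Suc (floor_log K) * (5 * 2 ^ Suc l * b)"
    if bound: "\<And>D. D \<subseteq> {1..K} \<Longrightarrow> acyclic (E \<inter> D \<times> D - Id) \<Longrightarrow> card D \<le> b" for b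
  proof -
    obtain D where D: "D \<subseteq> {1..K}" "acyclic (E \<inter> D \<times> D - Id)"
      "card {t \<in> rounds l. W t \<noteq> {}} \<le> (2 * 2 ^ Suc l + 1) * card D"
      using looped_rounds_mas by blast
    note D(3)
    also have "(2 * 2 ^ Suc l + 1) * card D \<le> (5 * 2 ^ Suc l) * b"
      using bound[OF D(1,2)] by (intro mult_le_mono) auto
    also have "\<dots> \<le> Suc (floor_log K) * (5 * 2 ^ Suc l * b)" by simp
    finally show ?thesis .
  qed
  show "card (costly l) \<le> 14 * Suc (floor_log K) * 2 ^ l * min (beta_bar M K E) (mas_number K E)"
  proof (cases "beta_bar M K E \<le> mas_number K E")
    case True
    have "beta_bar M K E \<ge> 1"
      using beta_pos[OF assms] beta_le_beta_bar le_trans by blast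
    moreover have "(\<Sum>i=1..M. card (I i)) \<le> beta_bar M K E" if "twin_free_family M K E I" for I
      using that by (intro le_beta_bar) (simp_all add: twin_free_family_def)
    ultimately have "card (costly l) \<le> 14 * Suc (floor_log K) * 2 ^ l * beta_bar M K E"
      by (intro main looped_rounds_family)
    then show ?thesis using True by (simp only: min_absorb1)
  next
    case False
    have "card (costly l) \<le> 14 * Suc (floor_log K) * 2 ^ l * mas_number K E"
      using mas_pos[OF assms(1)] by (intro main mas le_mas_number)
    then show ?thesis using False by (simp only: min_absorb2 nat_le_linear)
  qed
  show "card (costly l) \<le> 14 * Suc (floor_log K) * 2 ^ l * beta M K E" if "sym E \<or> trans E"
    using that
  proof
    assume "sym E"
    then show ?thesis
      using beta_pos[OF assms] assms(2) by (intro main mas mas_le_beta_sym)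
  next
    assume "trans E"
    then show ?thesis
      using beta_pos[OF assms] by (intro main looped_rounds_family twin_free_family_le_beta_trans)
  qed
qed

end

subsection \<open>Concentration under adaptive sampling\<close>

text \<open>The factor of round \<open>s\<close> is independent of the earlier factors and of the decision \<open>B s\<close>
  whether to include it.\<close>

lemma (in prob_space) adaptive_product_expectation_le_1:
  fixes g :: "nat \<Rightarrow> 'b \<Rightarrow> real"
  assumes indep: "indep_vars (\<lambda>_. N) X {..<T}"
    and B [measurable]: "\<And>s. s < T \<Longrightarrow> B s \<in> sets (PiM {..<s} (\<lambda>_. N))"
    and g [measurable]: "\<And>s. s < T \<Longrightarrow> g s \<in> borel_measurable N"
    and int: "\<And>s. s < T \<Longrightarrow> integrable M (\<lambda>\<omega>. g s (X s \<omega>))"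
    and le1: "\<And>s. s < T \<Longrightarrow> expectation (\<lambda>\<omega>. g s (X s \<omega>)) \<le> 1"
    and nonneg: "\<And>s y. 0 \<le> g s y"
    and t: "t \<le> T"
  defines "Z \<equiv> \<lambda>t \<omega>. \<Prod>s<t. if restrict (\<lambda>i. X i \<omega>) {..<s} \<in> B s then g s (X s \<omega>) else 1"
  shows "integrable M (Z t) \<and> expectation (Z t) \<le> 1"
  using t
proof (induction t)
  case 0
  show ?case by (simp add: Z_def prob_space)
next
  case (Suc t)
  then have t: "t < T" and IH: "integrable M (Z t)" "expectation (Z t) \<le> 1" by auto
  have rv: "random_variable N (X i)" if "i < T" for i
    using indep that by (auto simp: indep_vars_def)
  \<comment> \<open>\<open>F\<close> writes \<open>Z t\<close> times the inclusion indicator as a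
    function of the coordinates before \<open>t\<close>, so that independence of disjoint coordinate
    blocks separates it from the factor of round \<open>t\<close>.\<close>
  define F where "F = (\<lambda>f. (\<Prod>s<t. if restrict f {..<s} \<in> B s then g s (f s) else 1) * indicator (B t) f :: real)"
  let ?R = "\<lambda>\<omega>. restrict (\<lambda>i. X i \<omega>) {..<t}"
  have FR: "F (?R \<omega>) = Z t \<omega> * indicator (B t) (?R \<omega>)" for \<omega>
  proof -
    have "restrict (?R \<omega>) {..<s} = restrict (\<lambda>i. X i \<omega>) {..<s}" if "s < t" for s
      using that by (auto simp: restrict_def fun_eq_iff)
    then show ?thesis by (auto simp: F_def Z_def intro!: prod.cong)
  qed
  have F: "F \<in> borel_measurable (PiM {..<t} (\<lambda>_. N))"
  proof -
    have [measurable]: "(\<lambda>f. restrict f {..<s}) \<in> measurable (PiM {..<t} (\<lambda>_. N)) (PiM {..<s} (\<lambda>_. N))"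
      if "s < t" for s
      using that by (intro measurable_restrict_subset) auto
    have [measurable]: "(\<lambda>f. g s (f s)) \<in> borel_measurable (PiM {..<t} (\<lambda>_. N))" if "s < t" for s
      using that t by (intro measurable_compose[OF measurable_component_singleton, where g = "g s"] g) auto
    have [measurable]: "B s \<in> sets (PiM {..<s} (\<lambda>_. N))" if "s < t" for s
      using that t by (intro B) auto
    have [measurable]: "B t \<in> sets (PiM {..<t} (\<lambda>_. N))" using t by (rule B)
    have "(\<lambda>f. if restrict f {..<s} \<in> B s then g s (f s) else 1) \<in> borel_measurable (PiM {..<t} (\<lambda>_. N))"
      if "s < t" for s
      using that by measurable
    then show ?thesis unfolding F_def by (intro borel_measurable_times borel_measurable_prod) auto
  qed
  have ind: "indep_var borel (\<lambda>\<omega>. F (?R \<omega>)) borel (\<lambda>\<omega>. g t (X t \<omega>))"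
  proof -
    have "indep_var borel (F \<circ> ?R) borel ((\<lambda>f. g t (f t)) \<circ> (\<lambda>\<omega>. restrict (\<lambda>i. X i \<omega>) {t}))"
      using t F
      by (intro indep_var_compose[OF indep_var_restrict[OF indep]]
            measurable_compose[OF measurable_component_singleton, where g = "g t"] g) auto
    then show ?thesis by (simp add: comp_def)
  qed
  have Rm: "?R \<in> measurable M (PiM {..<t} (\<lambda>_. N))"
    using t by (intro measurable_restrict rv) auto
  have Bm: "B t \<in> sets (PiM {..<t} (\<lambda>_. N))" using t by (rule B)
  have im: "(\<lambda>\<omega>. indicator (B t) (?R \<omega>) :: real) \<in> borel_measurable M"
    using measurable_compose[OF Rm borel_measurable_indicator[OF Bm]] by simp
  have I1: "integrable M (\<lambda>\<omega>. Z t \<omega> * indicator (B t) (?R \<omega>))"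
    by (rule Bochner_Integration.integrable_bound[OF IH(1)])
      (use IH(1) im in \<open>auto simp: indicator_def split: if_splits\<close>)
  have I2: "integrable M (\<lambda>\<omega>. F (?R \<omega>) * g t (X t \<omega>))"
    using I1 by (intro indep_var_integrable ind int t) (simp add: FR)
  \<comment> \<open>The product changes only where round \<open>t\<close> is included; there the new
    factor has mean at most 1.\<close>
  have Zs: "Z (Suc t) = (\<lambda>\<omega>. (Z t \<omega> - Z t \<omega> * indicator (B t) (?R \<omega>)) + F (?R \<omega>) * g t (X t \<omega>))"
    by (auto simp: FR Z_def fun_eq_iff indicator_def)
  have Z0: "0 \<le> Z t \<omega>" for \<omega> by (auto simp: Z_def nonneg intro!: prod_nonneg)
  have "expectation (\<lambda>\<omega>. F (?R \<omega>) * g t (X t \<omega>)) = expectation (\<lambda>\<omega>. F (?R \<omega>)) * expectation (\<lambda>\<omega>. g t (X t \<omega>))"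
    using I1 by (intro indep_var_lebesgue_integral ind int t) (simp add: FR)
  also have "\<dots> \<le> expectation (\<lambda>\<omega>. F (?R \<omega>)) * 1"
    using Z0 le1[OF t] by (intro mult_left_mono) (auto simp: FR intro!: integral_nonneg)
  finally have "expectation (Z (Suc t)) \<le> expectation (Z t)"
    unfolding Zs using I1 I2 IH(1) by (simp add: FR)
  moreover have "integrable M (Z (Suc t))"
    unfolding Zs using I1 I2 IH(1) by simp
  ultimately show ?case using IH(2) by simp
qed

text \<open>Chernoff's method with the product above as exponential supermartingale. Fixing the
  random sample size to \<open>n\<close> makes the best exponent a constant.\<close>

lemma (in prob_space) adaptive_Hoeffding_upper:
  fixes h :: "'b \<Rightarrow> real" and T :: nat
  assumes indep: "indep_vars (\<lambda>_. N) X {..<T}"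
    and B: "\<And>s. s < T \<Longrightarrow> B s \<in> sets (PiM {..<s} (\<lambda>_. N))"
    and h [measurable]: "h \<in> borel_measurable N"
    and h01: "\<And>s. s < T \<Longrightarrow> AE \<omega> in M. h (X s \<omega>) \<in> {0..1}"
    and mean: "\<And>s. s < T \<Longrightarrow> expectation (\<lambda>\<omega>. h (X s \<omega>)) = m"
    and t: "t \<le> T" and n: "n \<ge> 1" and \<epsilon>: "\<epsilon> > 0"
  defines "S \<equiv> \<lambda>\<omega>. {s. s < t \<and> restrict (\<lambda>i. X i \<omega>) {..<s} \<in> B s}"
  shows "{\<omega> \<in> space M. card (S \<omega>) = n \<and> \<epsilon> \<le> (\<Sum>s\<in>S \<omega>. h (X s \<omega>) - m)} \<in> events" (is "?A \<in> _")
    and "prob {\<omega> \<in> space M. card (S \<omega>) = n \<and> \<epsilon> \<le> (\<Sum>s\<in>S \<omega>. h (X s \<omega>) - m)}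
           \<le> exp (- 2 * \<epsilon>\<^sup>2 / n)"
proof -
  have rv: "random_variable N (X i)" if "i < T" for i
    using indep that by (auto simp: indep_vars_def)
  have SB: "{\<omega> \<in> space M. s \<in> S \<omega>} \<in> events" if "s < t" for s
  proof -
    have "(\<lambda>\<omega>. restrict (\<lambda>i. X i \<omega>) {..<s}) \<in> measurable M (PiM {..<s} (\<lambda>_. N))"
    proof (rule measurable_restrict)
      fix i assume "i \<in> {..<s}"
      then show "random_variable N (X i)" using that t by (intro rv) simp
    qed
    moreover have "B s \<in> sets (PiM {..<s} (\<lambda>_. N))" using that t by (intro B) simp
    ultimately have "(\<lambda>\<omega>. restrict (\<lambda>i. X i \<omega>) {..<s}) -` B s \<inter> space M \<in> events"
      by (rule measurable_sets)
    also have "(\<lambda>\<omega>. restrict (\<lambda>i. X i \<omega>) {..<s}) -` B s \<inter> space M = {\<omega> \<in> space M. s \<in> S \<omega>}"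
      using that by (auto simp: S_def)
    finally show ?thesis .
  qed
  have hX: "(\<lambda>\<omega>. h (X s \<omega>)) \<in> borel_measurable M" if "s < t" for s
    using that t by (intro measurable_compose[OF rv h]) auto
  have S_sub: "S \<omega> \<subseteq> {..<t}" for \<omega> by (auto simp: S_def)
  have finS: "finite (S \<omega>)" for \<omega> by (rule finite_subset[OF S_sub]) simp
  have as_sum: "(\<Sum>s\<in>S \<omega>. f s) = (\<Sum>s<t. if s \<in> S \<omega> then f s else 0)" for \<omega> and f :: "nat \<Rightarrow> real"
    using S_sub[of \<omega>] by (simp add: sum.If_cases Int_absorb1)
  have gated: "(\<lambda>\<omega>. if s \<in> S \<omega> then f \<omega> else 0) \<in> borel_measurable M"
    if "s < t" "f \<in> borel_measurable M" for s and f :: "'a \<Rightarrow> real"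
    using SB[OF that(1)] that(2) by (intro measurable_If) auto
  have cardS: "real (card (S \<omega>)) = (\<Sum>s<t. if s \<in> S \<omega> then 1 else 0)" for \<omega>
    using as_sum[of "\<lambda>_. 1" \<omega>] by simp
  have m1: "(\<lambda>\<omega>. \<Sum>s<t. if s \<in> S \<omega> then h (X s \<omega>) - m else 0) \<in> borel_measurable M"
    by (intro borel_measurable_sum gated borel_measurable_diff hX) auto
  have m2: "(\<lambda>\<omega>. \<Sum>s<t. if s \<in> S \<omega> then 1 else (0::real)) \<in> borel_measurable M"
    by (intro borel_measurable_sum gated) auto
  have Aeq: "?A = {\<omega> \<in> space M. (\<Sum>s<t. if s \<in> S \<omega> then 1 else 0) = real n \<and>
      \<epsilon> \<le> (\<Sum>s<t. if s \<in> S \<omega> then h (X s \<omega>) - m else 0)}"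
    unfolding as_sum cardS[symmetric] by simp
  show A: "?A \<in> events"
    unfolding Aeq using m1 m2 by measurable
  \<comment> \<open>This value maximises l * \<epsilon> - l^2 * n / 8, with maximum 2 * \<epsilon>^2
    / n.\<close>
  define l where "l = 4 * \<epsilon> / n"
  have l: "l > 0" using n \<epsilon> by (simp add: l_def)
  \<comment> \<open>The division by \<open>exp (l\<^sup>2 / 8)\<close> brings the mean down to at
    most 1, by Hoeffding's lemma for a variable in [0, 1].\<close>
  define g where "g = (\<lambda>(s::nat) y. exp (l * (h y - m)) / exp (l\<^sup>2 / 8))"
  have gm: "g s \<in> borel_measurable N" for s by (simp add: g_def)
  have g_int: "integrable M (\<lambda>\<omega>. g s (X s \<omega>)) \<and> expectation (\<lambda>\<omega>. g s (X s \<omega>)) \<le> 1" if "s < T" for s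
  proof -
    have [measurable]: "(\<lambda>\<omega>. h (X s \<omega>)) \<in> borel_measurable M"
      using that by (intro measurable_compose[OF rv h]) auto
    interpret interval_bounded_random_variable M "\<lambda>\<omega>. h (X s \<omega>)" 0 1
      by unfold_locales (use h01[OF that] in auto)
    have "integrable M (\<lambda>\<omega>. g s (X s \<omega>))"
    proof (rule integrable_const_bound)
      show "AE \<omega> in M. norm (g s (X s \<omega>)) \<le> exp (l * (1 - m)) / exp (l\<^sup>2 / 8)"
        using h01[OF that] by eventually_elim (use l in \<open>auto simp: g_def intro!: divide_right_mono\<close>)
      show "(\<lambda>\<omega>. g s (X s \<omega>)) \<in> borel_measurable M" by (simp add: g_def)
    qed
    moreover have "ennreal (expectation (\<lambda>\<omega>. exp (l * (h (X s \<omega>) - m)))) \<le> ennreal (exp (l\<^sup>2 / 8))"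
    proof -
      have "integrable M (\<lambda>\<omega>. exp (l * (h (X s \<omega>) - m)))"
        using integrable_mult_left[OF calculation, of "exp (l\<^sup>2 / 8)"] by (simp add: g_def)
      then have "ennreal (expectation (\<lambda>\<omega>. exp (l * (h (X s \<omega>) - m)))) = (\<integral>\<^sup>+\<omega>. exp (l * (h (X s \<omega>) - m)) \<partial>M)"
        by (intro nn_integral_eq_integral[symmetric]) auto
      also have "\<dots> \<le> ennreal (exp (l\<^sup>2 / 8))"
        using Hoeffdings_lemma_nn_integral[OF l] by (simp add: mean[OF that])
      finally show ?thesis .
    qed
    then have "expectation (\<lambda>\<omega>. g s (X s \<omega>)) \<le> 1"
      by (subst (asm) ennreal_le_iff) (simp_all add: g_def)
    ultimately show ?thesis by blast
  qed
  define Z where "Z = (\<lambda>\<omega>. \<Prod>s<t. if restrict (\<lambda>i. X i \<omega>) {..<s} \<in> B s then g s (X s \<omega>) else 1)"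
  have Z: "integrable M Z" "expectation Z \<le> 1"
    using adaptive_product_expectation_le_1[OF indep B gm conjunct1[OF g_int] conjunct2[OF g_int] _ t]
    by (auto simp: Z_def g_def)
  have ZS: "Z \<omega> = exp (l * (\<Sum>s\<in>S \<omega>. h (X s \<omega>) - m) - l\<^sup>2 / 8 * card (S \<omega>))" for \<omega>
  proof -
    have "Z \<omega> = (\<Prod>s<t. if s \<in> S \<omega> then g s (X s \<omega>) else 1)"
      unfolding Z_def by (intro prod.cong) (auto simp: S_def)
    also have "\<dots> = (\<Prod>s\<in>S \<omega>. g s (X s \<omega>))"
      using S_sub[of \<omega>] by (simp add: prod.If_cases Int_absorb1)
    also have "\<dots> = (\<Prod>s\<in>S \<omega>. exp (l * (h (X s \<omega>) - m) - l\<^sup>2 / 8))"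
      by (simp add: g_def exp_diff)
    also have "\<dots> = exp (l * (\<Sum>s\<in>S \<omega>. h (X s \<omega>) - m) - l\<^sup>2 / 8 * card (S \<omega>))"
      using finS by (simp add: exp_sum[symmetric] sum_subtractf sum_distrib_left algebra_simps)
    finally show ?thesis .
  qed
  let ?c = "exp (l * \<epsilon> - l\<^sup>2 / 8 * n)"
  have "prob ?A \<le> prob {\<omega> \<in> space M. ?c \<le> Z \<omega>}"
  proof (rule finite_measure_mono)
    show "{\<omega> \<in> space M. ?c \<le> Z \<omega>} \<in> events" using Z(1) by measurable
    show "?A \<subseteq> {\<omega> \<in> space M. ?c \<le> Z \<omega>}" using l by (auto simp: ZS)
  qed
  also have "\<dots> \<le> expectation Z / ?c"
    by (rule integral_Markov_inequality_measure[where A = "{}"]) (simp_all add: Z(1), simp add: ZS)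
  also have "\<dots> \<le> 1 / ?c" using Z(2) by (intro divide_right_mono) auto
  also have "\<dots> = exp (- 2 * \<epsilon>\<^sup>2 / n)"
  proof -
    have "l\<^sup>2 / 8 * n = 2 * \<epsilon>\<^sup>2 / n" "l * \<epsilon> = 4 * \<epsilon>\<^sup>2 / n"
      using n by (simp_all add: l_def power2_eq_square)
    then have "l * \<epsilon> - l\<^sup>2 / 8 * n = - (- 2 * \<epsilon>\<^sup>2 / n)" by simp
    then show ?thesis by (simp only: exp_minus[of "- 2 * \<epsilon>\<^sup>2 / n"]) (simp add: inverse_eq_divide)
  qed
  finally show "prob ?A \<le> exp (- 2 * \<epsilon>\<^sup>2 / n)" .
qed

text \<open>The lower tail of \<open>h\<close> is the upper tail of 1 - \<open>h\<close>, with the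
  same inclusion events.\<close>

lemma (in prob_space) adaptive_Hoeffding:
  fixes h :: "'b \<Rightarrow> real" and T :: nat
  assumes indep: "indep_vars (\<lambda>_. N) X {..<T}"
    and B: "\<And>s. s < T \<Longrightarrow> B s \<in> sets (PiM {..<s} (\<lambda>_. N))"
    and h [measurable]: "h \<in> borel_measurable N"
    and h01: "\<And>s. s < T \<Longrightarrow> AE \<omega> in M. h (X s \<omega>) \<in> {0..1}"
    and mean: "\<And>s. s < T \<Longrightarrow> expectation (\<lambda>\<omega>. h (X s \<omega>)) = m"
    and t: "t \<le> T" and n: "n \<ge> 1" and \<epsilon>: "\<epsilon> > 0"
  defines "S \<equiv> \<lambda>\<omega>. {s. s < t \<and> restrict (\<lambda>i. X i \<omega>) {..<s} \<in> B s}"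
  shows "{\<omega> \<in> space M. card (S \<omega>) = n \<and> \<epsilon> \<le> \<bar>\<Sum>s\<in>S \<omega>. h (X s \<omega>) - m\<bar>} \<in> events" (is "?A \<in> _")
    and "prob {\<omega> \<in> space M. card (S \<omega>) = n \<and> \<epsilon> \<le> \<bar>\<Sum>s\<in>S \<omega>. h (X s \<omega>) - m\<bar>}
           \<le> 2 * exp (- 2 * \<epsilon>\<^sup>2 / n)"
proof -
  let ?A1 = "{\<omega> \<in> space M. card (S \<omega>) = n \<and> \<epsilon> \<le> (\<Sum>s\<in>S \<omega>. h (X s \<omega>) - m)}"
  let ?A2 = "{\<omega> \<in> space M. card (S \<omega>) = n \<and> \<epsilon> \<le> (\<Sum>s\<in>S \<omega>. (1 - h (X s \<omega>)) - (1 - m))}"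
  have neg: "(\<Sum>s\<in>S \<omega>. (1 - h (X s \<omega>)) - (1 - m)) = - (\<Sum>s\<in>S \<omega>. h (X s \<omega>) - m)" for \<omega>
    unfolding sum_negf[symmetric] by (intro sum.cong) auto
  have abs: "\<epsilon> \<le> \<bar>d\<bar> \<longleftrightarrow> \<epsilon> \<le> d \<or> \<epsilon> \<le> - d" for d :: real by linarith
  have eq: "?A = ?A1 \<union> ?A2"
    unfolding neg abs by blast
  have rv: "random_variable N (X i)" if "i < T" for i
    using indep that by (auto simp: indep_vars_def)
  have int: "integrable M (\<lambda>\<omega>. h (X s \<omega>))" if "s < T" for s
    by (rule integrable_const_bound[of _ 1], use h01[OF that] in eventually_elim)
      (auto intro: measurable_compose[OF rv[OF that] h])
  have A1: "?A1 \<in> events" "prob ?A1 \<le> exp (- 2 * \<epsilon>\<^sup>2 / n)"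
    unfolding S_def by (rule adaptive_Hoeffding_upper[OF indep B h h01 mean t n \<epsilon>]; assumption)+
  have h': "(\<lambda>y. 1 - h y) \<in> borel_measurable N" by simp
  have h01': "AE \<omega> in M. 1 - h (X s \<omega>) \<in> {0..1}" if "s < T" for s
    using h01[OF that] by eventually_elim auto
  have mean': "expectation (\<lambda>\<omega>. 1 - h (X s \<omega>)) = 1 - m" if "s < T" for s
    using mean[OF that] int[OF that] by (simp add: prob_space)
  have A2: "?A2 \<in> events" "prob ?A2 \<le> exp (- 2 * \<epsilon>\<^sup>2 / n)"
    unfolding S_def by (rule adaptive_Hoeffding_upper[OF indep B h' h01' mean' t n \<epsilon>]; assumption)+
  show "?A \<in> events" unfolding eq using A1(1) A2(1) by (rule sets.Un)
  show "prob ?A \<le> 2 * exp (- 2 * \<epsilon>\<^sup>2 / n)"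
    unfolding eq using measure_Un_le[OF A1(1) A2(1)] A1(2) A2(2) by linarith
qed

subsection \<open>The elimination policy\<close>

definition obs_count :: "(nat \<times> nat) set \<Rightarrow> nat list \<Rightarrow> nat \<Rightarrow> nat" where
  "obs_count E as a = card {s. s < length as \<and> (as ! s, a) \<in> E}"

definition emp_mean ::
  "(nat \<times> nat) set \<Rightarrow> nat list \<Rightarrow> (nat \<times> nat \<times> nat \<Rightarrow> real) \<Rightarrow> nat \<Rightarrow> nat \<Rightarrow> real" where
  "emp_mean E as \<omega> c a =
     (\<Sum>s\<in>{s. s < length as \<and> (as ! s, a) \<in> E}. \<omega> (s, c, a)) / real (obs_count E as a)"

text \<open>An unobserved arm has empirical mean 0 through division by zero; the successor then
  gives it width \<open>sqrt L\<close>, which covers [0, 1] once \<open>L \<ge> 1\<close>.\<close>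

definition width :: "real \<Rightarrow> (nat \<times> nat) set \<Rightarrow> nat list \<Rightarrow> nat \<Rightarrow> real" where
  "width L E as a = sqrt (L / real (Suc (obs_count E as a)))"

definition layer :: "(nat \<times> nat) set \<Rightarrow> nat list \<Rightarrow> nat \<Rightarrow> nat" where
  "layer E as a = floor_log (Suc (obs_count E as a))"

text \<open>The elimination test is repeated for every earlier round, so that active sets never grow.\<close>

definition active ::
  "real \<Rightarrow> nat \<Rightarrow> (nat \<times> nat) set \<Rightarrow> nat \<Rightarrow> nat list \<Rightarrow> (nat \<times> nat \<times> nat \<Rightarrow> real) \<Rightarrow> nat set" where
  "active L K E c as \<omega> = {a \<in> {1..K}. \<forall>s\<in>{..length as}. \<forall>b\<in>{1..K}.
     emp_mean E (take s as) \<omega> c b - width L E (take s as) b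
       \<le> emp_mean E (take s as) \<omega> c a + width L E (take s as) a}"

text \<open>Active sets can become empty when some confidence interval fails; the default 1 is then
  a legal action because \<open>K \<ge> 1\<close>.\<close>

definition decide ::
  "real \<Rightarrow> nat \<Rightarrow> (nat \<times> nat) set \<Rightarrow> nat list \<Rightarrow> nat set \<Rightarrow> nat" where
  "decide L K E as A = (if A = {} then 1 else SOME a. greedy_choice E (layer E as) A a)"

definition elimination_policy :: "real \<Rightarrow> nat \<Rightarrow> (nat \<times> nat) set \<Rightarrow> policy" where
  "elimination_policy L K E cs as \<omega> =
     return_pmf (decide L K E as (active L K E (last cs) as \<omega>))"

lemma active_sub: "active L K E c as \<omega> \<subseteq> {1..K}"
  unfolding active_def by (rule Collect_restrict)

lemma finite_active: "finite (active L K E c as \<omega>)"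
  by (rule finite_subset[OF active_sub finite_atLeastAtMost])

lemma decide_greedy:
  assumes "A \<noteq> {}" "finite A"
  shows "greedy_choice E (layer E as) A (decide L K E as A)"
  unfolding decide_def if_not_P[OF assms(1)] by (rule someI_ex[OF greedy_choice_exists[OF assms(2,1)]])

lemma decide_active_in:
  assumes "K \<ge> 1"
  shows "decide L K E as (active L K E c as \<omega>) \<in> {1..K}"
proof (cases "active L K E c as \<omega> = {}")
  case True
  then show ?thesis using assms by (simp add: decide_def)
next
  case False
  then show ?thesis
    using decide_greedy[OF False finite_active] active_sub unfolding greedy_choice_def by blast
qed

text \<open>With finitely many values, the random active set is measurable into the discrete space,
  so any choice made from it, including the arbitrary one in \<open>decide\<close>, is measurable
  too.\<close>

lemma measurable_finite_Collect:
  assumes "finite S" "\<And>a. a \<in> S \<Longrightarrow> Measurable.pred N (P a)"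
  shows "(\<lambda>x. {a \<in> S. P a x}) \<in> measurable N (count_space UNIV)"
proof -
  have "(\<lambda>x. {a \<in> S. P a x}) \<in> measurable N (count_space (Pow S))"
  proof (subst measurable_count_space_eq2)
    show "finite (Pow S)" using assms(1) by simp
    show "(\<lambda>x. {a \<in> S. P a x}) \<in> space N \<rightarrow> Pow S \<and>
      (\<forall>B\<in>Pow S. (\<lambda>x. {a \<in> S. P a x}) -` {B} \<inter> space N \<in> sets N)"
    proof (intro conjI ballI)
      fix B assume "B \<in> Pow S"
      then have "(\<lambda>x. {a \<in> S. P a x}) -` {B} \<inter> space N = {x \<in> space N. \<forall>a\<in>S. P a x = (a \<in> B)}"
        by auto
      also have "\<dots> \<in> sets N"
        using assms by measurable
      finally show "(\<lambda>x. {a \<in> S. P a x}) -` {B} \<inter> space N \<in> sets N" .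
    qed auto
  qed
  from measurable_compose[OF this, of "\<lambda>B. B" "count_space UNIV"] show ?thesis by simp
qed

lemma measurable_emp_mean:
  assumes "\<And>s. s < length as \<Longrightarrow> (as ! s, a) \<in> E \<Longrightarrow> (\<lambda>x. f x (s, c, a)) \<in> borel_measurable N"
  shows "(\<lambda>x. emp_mean E (take t as) (f x) c a) \<in> borel_measurable N"
  unfolding emp_mean_def using assms by (intro borel_measurable_divide borel_measurable_sum) auto

lemma measurable_decide:
  assumes "\<And>s a. s < length as \<Longrightarrow> (as ! s, a) \<in> E \<Longrightarrow> a \<in> {1..K} \<Longrightarrow>
    (\<lambda>x. f x (s, c, a)) \<in> borel_measurable N"
  shows "(\<lambda>x. decide L K E as (active L K E c as (f x))) \<in> measurable N (count_space UNIV)"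
proof -
  have m: "(\<lambda>x. emp_mean E (take t as) (f x) c a) \<in> borel_measurable N" if "a \<in> {1..K}" for t a
    using that by (intro measurable_emp_mean assms) auto
  have "(\<lambda>x. active L K E c as (f x)) \<in> measurable N (count_space UNIV)"
    unfolding active_def
  proof (rule measurable_finite_Collect)
    fix a assume a: "a \<in> {1..K}"
    show "Measurable.pred N (\<lambda>x. \<forall>s\<in>{..length as}. \<forall>b\<in>{1..K}.
      emp_mean E (take s as) (f x) c b - width L E (take s as) b
        \<le> emp_mean E (take s as) (f x) c a + width L E (take s as) a)"
    proof (intro pred_intros_finite)
      fix s b assume b: "b \<in> {1..K}"
      note [measurable] = m[OF a] m[OF b]
      show "Measurable.pred N (\<lambda>x. emp_mean E (take s as) (f x) c b - width L E (take s as) b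
        \<le> emp_mean E (take s as) (f x) c a + width L E (take s as) a)"
        by measurable
    qed simp_all
  qed simp
  then show ?thesis
    by (rule measurable_compose) simp
qed

lemma elimination_policy_is_policy:
  assumes "K \<ge> 1"
  shows "is_policy T K M E (elimination_policy L K E)"
  unfolding is_policy_def
proof (intro allI impI conjI)
  fix cs as \<omega>
  show "set_pmf (elimination_policy L K E cs as \<omega>) \<subseteq> {1..K}"
    using decide_active_in[OF assms] by (simp add: elimination_policy_def)
next
  fix cs as :: "nat list" and a
  assume cs: "set cs \<subseteq> {1..M}" and len: "length cs = Suc (length as)"
  have c: "last cs \<in> {1..M}" using cs len last_in_set[of cs] by (cases cs) auto
  let ?N = "PiM (observed M K E as) (\<lambda>_. borel :: real measure)"
  have "(\<lambda>\<omega>. decide L K E as (active L K E (last cs) as \<omega>)) \<in> measurable ?N (count_space UNIV)"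
    using c by (intro measurable_decide measurable_component_singleton) (auto simp: observed_def)
  then have "(\<lambda>\<omega>. pmf (return_pmf (decide L K E as (active L K E (last cs) as \<omega>))) a) \<in> borel_measurable ?N"
    by (rule measurable_compose) simp
  then show "(\<lambda>\<omega>. pmf (elimination_policy L K E cs as \<omega>) a) \<in> borel_measurable ?N"
    by (simp add: elimination_policy_def)
qed

text \<open>Lets the analysis run the policy on the full reward table; the actions agree because its
  statistics read observed entries only.\<close>

definition raw :: "(nat \<Rightarrow> nat \<times> nat \<Rightarrow> real) \<Rightarrow> nat \<times> nat \<times> nat \<Rightarrow> real" where
  "raw r = (\<lambda>(s, c, a). r s (c, a))"

lemma emp_mean_observation:
  assumes "c \<in> {1..M}" "a \<in> {1..K}"
  shows "emp_mean E (take t as) (observation M K E as r) c a = emp_mean E (take t as) (raw r) c a"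
proof -
  have "(\<Sum>s\<in>{s. s < length (take t as) \<and> (take t as ! s, a) \<in> E}. observation M K E as r (s, c, a))
      = (\<Sum>s\<in>{s. s < length (take t as) \<and> (take t as ! s, a) \<in> E}. raw r (s, c, a))"
    using assms by (intro sum.cong) (auto simp: observation_def observed_def raw_def)
  then show ?thesis by (simp only: emp_mean_def)
qed

lemma active_observation:
  assumes "c \<in> {1..M}"
  shows "active L K E c as (observation M K E as r) = active L K E c as (raw r)"
proof -
  have "emp_mean E (take s as) (observation M K E as r) c a = emp_mean E (take s as) (raw r) c a"
    if "a \<in> {1..K}" for s a
    by (rule emp_mean_observation[OF assms that])
  then show ?thesis unfolding active_def by (simp cong: conj_cong)
qed

section \<open>The trajectory as a function of the rewards\<close>

locale bandit =
  fixes K M T :: nat and E :: "(nat \<times> nat) set" and L :: real and ctx :: "nat \<Rightarrow> nat"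
  assumes K: "K \<ge> 1" and edges: "E \<subseteq> {1..K} \<times> {1..K}"
    and strong: "strongly_observable K E" and L: "L \<ge> 1"
    and ctx: "\<And>t. t < T \<Longrightarrow> ctx t \<in> {1..M}"
begin

primrec hist :: "(nat \<Rightarrow> nat \<times> nat \<Rightarrow> real) \<Rightarrow> nat \<Rightarrow> nat list" where
  "hist r 0 = []"
| "hist r (Suc t) = hist r t @ [decide L K E (hist r t) (active L K E (ctx t) (hist r t) (raw r))]"

definition arm :: "(nat \<Rightarrow> nat \<times> nat \<Rightarrow> real) \<Rightarrow> nat \<Rightarrow> nat" where
  "arm r t = decide L K E (hist r t) (active L K E (ctx t) (hist r t) (raw r))"

lemma hist_map: "hist r t = map (arm r) [0..<t]"
  by (induction t) (auto simp: arm_def)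

lemma length_hist [simp]: "length (hist r t) = t"
  by (simp add: hist_map)

lemma take_hist: "s \<le> t \<Longrightarrow> take s (hist r t) = hist r s"
  by (simp add: hist_map take_map)

lemma nth_hist: "s < t \<Longrightarrow> hist r t ! s = arm r s"
  by (simp add: hist_map)

lemma arm_in: "arm r t \<in> {1..K}"
  unfolding arm_def by (rule decide_active_in[OF K])

lemma play_eq:
  "t \<le> T \<Longrightarrow> play M K E (elimination_policy L K E) ctx r t = return_pmf (hist r t)"
  by (induction t) (simp_all add: elimination_policy_def bind_return_pmf active_observation[OF ctx])

lemma active_cong:
  assumes "\<And>s. s < length as \<Longrightarrow> r s = r' s"
  shows "active L K E c as (raw r) = active L K E c as (raw r')"
proof -
  have "emp_mean E (take t as) (raw r) c a = emp_mean E (take t as) (raw r') c a" for t a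
    unfolding emp_mean_def using assms
    by (intro arg_cong2[where f = "(/)"] sum.cong) (auto simp: raw_def)
  then show ?thesis by (simp add: active_def)
qed

text \<open>The last action of a history of length \<open>t\<close> is chosen before the reward of
  round t - 1 is seen; hence the shift \<open>Suc s < t\<close>, which makes the actions
  predictable.\<close>

lemma hist_cong: "(\<And>s. Suc s < t \<Longrightarrow> r s = r' s) \<Longrightarrow> hist r t = hist r' t"
proof (induction t)
  case (Suc t)
  then have "hist r t = hist r' t" by simp
  then show ?case using active_cong[of "hist r' t" r r'] Suc.prems by simp
qed simp

lemma arm_cong:
  assumes "\<And>s. s < t \<Longrightarrow> r s = r' s"
  shows "arm r t = arm r' t"
proof -
  have "hist r (Suc t) = hist r' (Suc t)"
    by (rule hist_cong) (rule assms, simp)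
  then show ?thesis by (metis nth_hist lessI)
qed

lemma measurable_reward:
  assumes "s < J" "c \<in> {1..M}" "a \<in> {1..K}"
  shows "(\<lambda>r. r s (c, a)) \<in> borel_measurable (PiM {..<J} (\<lambda>_. reward_space M K))"
proof -
  have "(\<lambda>r. r s) \<in> measurable (PiM {..<J} (\<lambda>_. reward_space M K)) (reward_space M K)"
    using assms by (intro measurable_component_singleton) simp
  moreover have "(\<lambda>v. v (c, a)) \<in> borel_measurable (reward_space M K)"
    unfolding reward_space_def using assms by (intro measurable_component_singleton) simp
  ultimately show ?thesis by (rule measurable_compose)
qed

lemma measurable_hist:
  "t \<le> Suc J \<Longrightarrow> t \<le> T \<Longrightarrow>
     (\<lambda>r. hist r t) \<in> measurable (PiM {..<J} (\<lambda>_. reward_space M K)) (count_space UNIV)"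
proof (induction t)
  case (Suc t)
  let ?N = "PiM {..<J} (\<lambda>_. reward_space M K)"
  \<comment> \<open>Histories have countably many values, so each may be fixed in turn. The length
    guard keeps the fixed list from referring to rounds outside \<open>{..<J}\<close>.\<close>
  define f where "f = (\<lambda>as r. if length as = t then as @ [decide L K E as (active L K E (ctx t) as (raw r))] else [])"
  have f: "f as \<in> measurable ?N (count_space UNIV)" for as
  proof (cases "length as = t")
    case True
    have "(\<lambda>r. decide L K E as (active L K E (ctx t) as (raw r))) \<in> measurable ?N (count_space UNIV)"
      using True Suc.prems ctx[of t]
      by (intro measurable_decide) (auto simp: raw_def intro!: measurable_reward)
    then have "(\<lambda>r. as @ [decide L K E as (active L K E (ctx t) as (raw r))]) \<in> measurable ?N (count_space UNIV)"
      by (rule measurable_compose) simp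
    then show ?thesis using True by (simp add: f_def)
  qed (simp add: f_def)
  have "(\<lambda>r. hist r t) \<in> measurable ?N (count_space UNIV)"
    using Suc by simp
  from measurable_compose_countable[OF f this]
  have "(\<lambda>r. f (hist r t) r) \<in> measurable ?N (count_space UNIV)" .
  then show ?case by (simp add: f_def)
qed simp

text \<open>Observing \<open>a\<close> in round \<open>s\<close> depends on the rewards before
  \<open>s\<close> only: this is the inclusion event to which the concentration bound is
  applied.\<close>

lemma arm_event:
  assumes "s < T"
  shows "{r \<in> space (PiM {..<s} (\<lambda>_. reward_space M K)). (arm r s, a) \<in> E}
    \<in> sets (PiM {..<s} (\<lambda>_. reward_space M K))"
proof -
  have h: "(\<lambda>r. hist r (Suc s)) \<in> measurable (PiM {..<s} (\<lambda>_. reward_space M K)) (count_space UNIV)"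
    using assms by (intro measurable_hist) auto
  have g: "(\<lambda>as. (as ! s, a) \<in> E) \<in> measurable (count_space UNIV) (count_space UNIV)"
    by simp
  have "Measurable.pred (PiM {..<s} (\<lambda>_. reward_space M K)) (\<lambda>r. (hist r (Suc s) ! s, a) \<in> E)"
    by (rule measurable_compose[OF h g])
  then show ?thesis
    by (simp only: nth_hist lessI pred_def)
qed

lemma obs_count_hist: "obs_count E (hist r t) a = card {s. s < t \<and> (arm r s, a) \<in> E}"
  unfolding obs_count_def by (simp add: nth_hist cong: conj_cong)

lemma emp_mean_hist:
  "emp_mean E (hist r t) (raw r) c a =
     (\<Sum>s\<in>{s. s < t \<and> (arm r s, a) \<in> E}. r s (c, a)) / real (obs_count E (hist r t) a)"
  unfolding emp_mean_def raw_def by (simp add: nth_hist cong: conj_cong)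

definition accurate :: "(nat \<times> nat \<Rightarrow> real) \<Rightarrow> (nat \<Rightarrow> nat \<times> nat \<Rightarrow> real) \<Rightarrow> bool" where
  "accurate \<mu> r \<longleftrightarrow> (\<forall>t<T. \<forall>c\<in>{1..M}. \<forall>a\<in>{1..K}.
     \<bar>emp_mean E (hist r t) (raw r) c a - \<mu> (c, a)\<bar> \<le> width L E (hist r t) a)"

text \<open>A union bound over round, sample size, context and arm; the sample size is an index of
  its own because the concentration bound fixes it.\<close>

lemma prob_inaccurate:
  assumes env: "(\<mu>, P) \<in> environments M K T"
  shows "\<exists>B. B \<in> sets P \<and> {r \<in> space P. \<not> accurate \<mu> r} \<subseteq> B \<and>
    measure P B \<le> real (T * T * M * K) * (2 * exp (- L))"
proof -
  have P: "prob_space P" and sets_P: "sets P = sets (PiM {..<T} (\<lambda>_. reward_space M K))"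
    and indep: "prob_space.indep_vars P (\<lambda>_. reward_space M K) (\<lambda>t r. r t) {..<T}"
    and in01: "\<And>t c a. t < T \<Longrightarrow> c \<in> {1..M} \<Longrightarrow> a \<in> {1..K} \<Longrightarrow> AE r in P. r t (c, a) \<in> {0..1}"
    and mean: "\<And>t c a. t < T \<Longrightarrow> c \<in> {1..M} \<Longrightarrow> a \<in> {1..K} \<Longrightarrow> (\<integral>r. r t (c, a) \<partial>P) = \<mu> (c, a)"
    using env unfolding environments_def by auto
  interpret prob_space P by (rule P)
  have sp: "space P = space (PiM {..<T} (\<lambda>_. reward_space M K))"
    by (rule sets_eq_imp_space_eq[OF sets_P])
  define Ev where "Ev = (\<lambda>a s. {r \<in> space (PiM {..<s} (\<lambda>_. reward_space M K)). (arm r s, a) \<in> E})"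
  have Ev: "Ev a s \<in> sets (PiM {..<s} (\<lambda>_. reward_space M K))" if "s < T" for a s
    unfolding Ev_def by (rule arm_event[OF that])
  have restr: "restrict (\<lambda>i. r i) {..<s} \<in> Ev a s \<longleftrightarrow> (arm r s, a) \<in> E"
    if "r \<in> space P" "s < T" for r s a
  proof -
    have "restrict (\<lambda>i. r i) {..<s} \<in> space (PiM {..<s} (\<lambda>_. reward_space M K))"
      using that by (auto simp: sp space_PiM PiE_iff)
    moreover have "arm (restrict (\<lambda>i. r i) {..<s}) s = arm r s"
      by (rule arm_cong) simp
    ultimately show ?thesis by (simp add: Ev_def)
  qed
  define S where "S = (\<lambda>a t r. {s. s < t \<and> restrict (\<lambda>i. r i) {..<s} \<in> Ev a s})"
  have S_eq: "S a t r = {s. s < t \<and> (arm r s, a) \<in> E}" if "r \<in> space P" "t \<le> T" for a t r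
    using restr[OF that(1)] that(2) unfolding S_def by (meson order_less_le_trans)
  \<comment> \<open>The confidence width after \<open>n\<close> observations, rescaled from a mean
    to a sum.\<close>
  define eps where "eps = (\<lambda>n::nat. real n * sqrt (L / real (Suc n)))"
  define F where "F = (\<lambda>(t, n, c, a). {r \<in> space P. card (S a t r) = n \<and>
     eps n \<le> \<bar>\<Sum>s\<in>S a t r. r s (c, a) - \<mu> (c, a)\<bar>})"
  define Idx where "Idx = {..<T} \<times> {1..T} \<times> {1..M} \<times> {1..K}"
  have F: "F i \<in> sets P \<and> measure P (F i) \<le> 2 * exp (- L)" if "i \<in> Idx" for i
  proof -
    obtain t n c a where i: "i = (t, n, c, a)" "t < T" "1 \<le> n" "c \<in> {1..M}" "a \<in> {1..K}"
      using \<open>i \<in> Idx\<close> by (auto simp: Idx_def)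
    have h: "(\<lambda>v. v (c, a)) \<in> borel_measurable (reward_space M K)"
      unfolding reward_space_def using i by (intro measurable_component_singleton) simp
    have pos: "eps n > 0" using i(3) L by (simp add: eps_def)
    have 1: "F i \<in> sets P" "measure P (F i) \<le> 2 * exp (- 2 * (eps n)\<^sup>2 / n)"
      unfolding F_def S_def i(1) prod.case
      by (rule adaptive_Hoeffding[where h = "\<lambda>v. v (c, a)" and B = "Ev a" and X = "\<lambda>t r. r t",
            OF indep Ev h in01[OF _ i(4,5)] mean[OF _ i(4,5)]
            less_imp_le[OF i(2)] i(3) pos]; assumption)+
    have "0 \<le> L / real (Suc n)" using L by simp
    then have "(eps n)\<^sup>2 = (real n)\<^sup>2 * (L / real (Suc n))"
      unfolding eps_def power_mult_distrib by (simp only: real_sqrt_pow2)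
    then have "2 * (eps n)\<^sup>2 / n = 2 * real n * L / real (Suc n)"
      using i(3) by (simp add: power2_eq_square)
    \<comment> \<open>Since n \<ge> 1, the ratio 2n / (n + 1) is at least 1: the successor in the
      width is paid for by the 2 in Hoeffding's exponent.\<close>
    moreover have "L * real (Suc n) \<le> 2 * real n * L"
      using i(3) L by (simp add: algebra_simps)
    ultimately have "L \<le> 2 * (eps n)\<^sup>2 / n"
      by (simp add: le_divide_eq del: of_nat_Suc)
    then have "exp (- 2 * (eps n)\<^sup>2 / n) \<le> exp (- L)" by simp
    with 1 show ?thesis by linarith
  qed
  have finI: "finite Idx" by (simp add: Idx_def)
  have cardI: "card Idx = T * T * M * K" by (simp add: Idx_def card_cartesian_product)
  let ?B = "\<Union>i\<in>Idx. F i"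
  have B: "?B \<in> sets P" using F finI by blast
  have "measure P ?B \<le> (\<Sum>i\<in>Idx. measure P (F i))"
    using F by (intro finite_measure_subadditive_finite finI) blast
  also have "\<dots> \<le> (\<Sum>i\<in>Idx. 2 * exp (- L))"
    using F by (intro sum_mono) blast
  also have "\<dots> = real (T * T * M * K) * (2 * exp (- L))"
    by (simp only: sum_constant cardI)
  finally have mB: "measure P ?B \<le> real (T * T * M * K) * (2 * exp (- L))" .
  have "{r \<in> space P. \<not> accurate \<mu> r} \<subseteq> ?B"
  proof
    fix r assume "r \<in> {r \<in> space P. \<not> accurate \<mu> r}"
    then obtain t c a where r: "r \<in> space P" and t: "t < T" and c: "c \<in> {1..M}" and a: "a \<in> {1..K}"
      and dev: "width L E (hist r t) a < \<bar>emp_mean E (hist r t) (raw r) c a - \<mu> (c, a)\<bar>"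
      unfolding accurate_def by (auto simp: not_le)
    define n where "n = obs_count E (hist r t) a"
    have n: "n = card (S a t r)"
      using S_eq[OF r less_imp_le[OF t]] by (simp add: n_def obs_count_hist)
    have mu: "\<bar>\<mu> (c, a)\<bar> \<le> 1"
    proof -
      have "integrable P (\<lambda>r. r t (c, a))"
      proof (rule integrable_const_bound[of _ 1])
        show "AE r in P. norm (r t (c, a)) \<le> 1"
          using in01[OF t c a] by eventually_elim auto
        have "(\<lambda>r. r t (c, a)) \<in> borel_measurable (PiM {..<T} (\<lambda>_. reward_space M K))"
          by (rule measurable_reward[OF t c a])
        then show "(\<lambda>r. r t (c, a)) \<in> borel_measurable P"
          by (simp only: measurable_cong_sets[OF sets_P refl])
      qed
      then have "\<bar>\<integral>r. r t (c, a) \<partial>P\<bar> \<le> (\<integral>r. 1 \<partial>P)"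
        using in01[OF t c a] by (intro integral_abs_bound[THEN order_trans] integral_mono_AE) (auto elim: eventually_mono)
      then show ?thesis by (simp add: mean[OF t c a] prob_space)
    qed
    have "n \<noteq> 0"
    proof
      assume "n = 0"
      then have "obs_count E (hist r t) a = 0" by (simp add: n_def)
      then have "sqrt L < \<bar>\<mu> (c, a)\<bar>" using dev by (simp add: emp_mean_def width_def)
      moreover have "1 \<le> sqrt L" using L by simp
      ultimately show False using mu by linarith
    qed
    have "card (S a t r) \<le> card {..<t}" by (rule card_mono) (auto simp: S_def)
    then have nT: "n \<in> {1..T}" using \<open>n \<noteq> 0\<close> n t by simp
    have "(\<Sum>s\<in>S a t r. r s (c, a) - \<mu> (c, a)) = n * (emp_mean E (hist r t) (raw r) c a - \<mu> (c, a))"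
      using \<open>n \<noteq> 0\<close> S_eq[OF r less_imp_le[OF t]] n
      by (simp add: emp_mean_hist sum_subtractf n_def[symmetric] right_diff_distrib)
    then have "\<bar>\<Sum>s\<in>S a t r. r s (c, a) - \<mu> (c, a)\<bar>
        = n * \<bar>emp_mean E (hist r t) (raw r) c a - \<mu> (c, a)\<bar>"
      by (simp add: abs_mult)
    moreover have "eps n \<le> n * \<bar>emp_mean E (hist r t) (raw r) c a - \<mu> (c, a)\<bar>"
      unfolding eps_def using dev by (intro mult_left_mono) (simp_all add: width_def n_def)
    ultimately have "r \<in> F (t, n, c, a)" using r n by (simp add: F_def)
    moreover have "(t, n, c, a) \<in> Idx" using t nT c a by (simp add: Idx_def)
    ultimately show "r \<in> ?B" by blast
  qed
  with B mB show ?thesis by blast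
qed

end

subsection \<open>The regret bound\<close>

lemma floor_log_le_ln:
  assumes "n \<ge> 1"
  shows "real (floor_log n) \<le> 2 * ln (real n)"
proof -
  have "real (2 ^ floor_log n) \<le> real n"
    using floor_log_exp2_le[of n] assms by (intro of_nat_mono) simp
  then have "ln (2 ^ floor_log n) \<le> ln (real n)"
    by (subst ln_le_cancel_iff) (use assms in auto)
  then have "real (floor_log n) * ln 2 \<le> ln (real n)" by (simp add: ln_realpow)
  moreover have "real (floor_log n) * (1 / 2) \<le> real (floor_log n) * ln 2"
    using ln2_ge_two_thirds by (intro mult_left_mono) auto
  ultimately show ?thesis by linarith
qed

context bandit
begin

text \<open>Correct intervals place the lower bound of any arm below its mean and the upper bound of
  an optimal arm above the optimal mean, so an optimal arm passes every test and active sets stay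
  nonempty.\<close>

lemma elimination_run_of_accurate:
  assumes acc: "accurate \<mu> r"
  shows "elimination_run K M T E (arm r) ctx (\<lambda>t i. active L K E i (hist r t) (raw r)) (\<lambda>t. layer E (hist r t))"
    and "\<And>t a. t < T \<Longrightarrow> a \<in> {1..K} \<Longrightarrow> \<forall>b\<in>{1..K}. \<mu> (ctx t, b) \<le> \<mu> (ctx t, a)
      \<Longrightarrow> a \<in> active L K E (ctx t) (hist r t) (raw r)"
proof -
  show opt: "a \<in> active L K E (ctx t) (hist r t) (raw r)"
    if t: "t < T" and a: "a \<in> {1..K}" and max: "\<forall>b\<in>{1..K}. \<mu> (ctx t, b) \<le> \<mu> (ctx t, a)" for t a
    unfolding active_def
  proof (intro CollectI conjI a ballI)
    fix s b assume "s \<in> {..length (hist r t)}" and b: "b \<in> {1..K}"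
    then have s: "s \<le> t" "s < T" using t by auto
    have dev: "\<bar>emp_mean E (hist r s) (raw r) (ctx t) i - \<mu> (ctx t, i)\<bar> \<le> width L E (hist r s) i"
      if "i \<in> {1..K}" for i
      using acc s(2) ctx[OF t] that unfolding accurate_def by blast
    show "emp_mean E (take s (hist r t)) (raw r) (ctx t) b - width L E (take s (hist r t)) b
      \<le> emp_mean E (take s (hist r t)) (raw r) (ctx t) a + width L E (take s (hist r t)) a"
      using dev[OF a] dev[OF b] bspec[OF max b] unfolding take_hist[OF s(1)] abs_le_iff by linarith
  qed
  have ne: "active L K E (ctx t) (hist r t) (raw r) \<noteq> {}" if t: "t < T" for t
  proof -
    have "Max ((\<lambda>a. \<mu> (ctx t, a)) ` {1..K}) \<in> (\<lambda>a. \<mu> (ctx t, a)) ` {1..K}"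
      using K by (intro Max_in) auto
    then obtain a where a: "a \<in> {1..K}" "Max ((\<lambda>a. \<mu> (ctx t, a)) ` {1..K}) = \<mu> (ctx t, a)" by auto
    have "\<forall>b\<in>{1..K}. \<mu> (ctx t, b) \<le> \<mu> (ctx t, a)"
      unfolding a(2)[symmetric] by (auto intro!: Max_ge)
    then show ?thesis using opt[OF t a(1)] by blast
  qed
  show "elimination_run K M T E (arm r) ctx (\<lambda>t i. active L K E i (hist r t) (raw r)) (\<lambda>t. layer E (hist r t))"
  proof
    show "active L K E i (hist r t) (raw r) \<subseteq> active L K E i (hist r s) (raw r)" if "s \<le> t" for s t i
    proof
      fix a assume a: "a \<in> active L K E i (hist r t) (raw r)"
      show "a \<in> active L K E i (hist r s) (raw r)"
        unfolding active_def
      proof (intro CollectI conjI ballI)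
        show "a \<in> {1..K}" using a by (simp add: active_def)
        fix q b assume "q \<in> {..length (hist r s)}" and b: "b \<in> {1..K}"
        then have q: "q \<le> s" "q \<le> t" "q \<in> {..length (hist r t)}" using that by auto
        from a have "emp_mean E (take q (hist r t)) (raw r) i b - width L E (take q (hist r t)) b
          \<le> emp_mean E (take q (hist r t)) (raw r) i a + width L E (take q (hist r t)) a"
          using q(3) b unfolding active_def by blast
        then show "emp_mean E (take q (hist r s)) (raw r) i b - width L E (take q (hist r s)) b
          \<le> emp_mean E (take q (hist r s)) (raw r) i a + width L E (take q (hist r s)) a"
          unfolding take_hist[OF q(1)] take_hist[OF q(2)] .
      qed
    qed
    show "greedy_choice E (layer E (hist r t)) (active L K E (ctx t) (hist r t) (raw r)) (arm r t)" if "t < T" for t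
      unfolding arm_def by (rule decide_greedy[OF ne[OF that] finite_active])
    show "layer E (hist r t) a = floor_log (Suc (card {s. s < t \<and> (arm r s, a) \<in> E}))" for t a
      by (simp add: layer_def obs_count_hist)
  qed (use edges strong ctx active_sub ne in auto)
qed

text \<open>The test of \<open>a\<close> against \<open>b\<close> costs one width of each arm, and
  passing from empirical to true means another of each; hence the constant 4.\<close>

lemma gap_le_of_active:
  assumes acc: "accurate \<mu> r" and t: "t < T"
    and a: "a \<in> active L K E (ctx t) (hist r t) (raw r)" and b: "b \<in> {1..K}"
    and lev: "\<And>i. i \<in> {a, b} \<Longrightarrow> l \<le> layer E (hist r t) i"
  shows "\<mu> (ctx t, b) - \<mu> (ctx t, a) \<le> 4 * sqrt (L / 2 ^ l)"
proof -
  have aK: "a \<in> {1..K}" using a active_sub by blast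
  have dev: "\<bar>emp_mean E (hist r t) (raw r) (ctx t) i - \<mu> (ctx t, i)\<bar> \<le> width L E (hist r t) i"
    if "i \<in> {1..K}" for i
    using acc t ctx[OF t] that unfolding accurate_def by blast
  have w: "width L E (hist r t) i \<le> sqrt (L / 2 ^ l)" if "i \<in> {a, b}" for i
  proof -
    have "(2::nat) ^ l \<le> 2 ^ layer E (hist r t) i"
      using lev[OF that] by (intro power_increasing) auto
    also have "\<dots> \<le> Suc (obs_count E (hist r t) i)"
      unfolding layer_def by (rule floor_log_exp2_le) simp
    finally have "real (2 ^ l) \<le> real (Suc (obs_count E (hist r t) i))" by (rule of_nat_mono)
    then show ?thesis
      unfolding width_def using L by (intro real_sqrt_le_mono divide_left_mono) auto
  qed
  have "\<forall>s\<in>{..length (hist r t)}. \<forall>b\<in>{1..K}.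
    emp_mean E (take s (hist r t)) (raw r) (ctx t) b - width L E (take s (hist r t)) b
      \<le> emp_mean E (take s (hist r t)) (raw r) (ctx t) a + width L E (take s (hist r t)) a"
    using a by (simp add: active_def)
  from bspec[OF bspec[OF this, of t] b]
  have "emp_mean E (hist r t) (raw r) (ctx t) b - width L E (hist r t) b
      \<le> emp_mean E (hist r t) (raw r) (ctx t) a + width L E (hist r t) a"
    by simp
  then show ?thesis
    using dev[OF aK] dev[OF b] w[of a] w[of b] unfolding abs_le_iff by simp
qed

lemma regret_of_accurate:
  assumes acc: "accurate \<mu> r" and D: "D \<ge> 0"
    and costly: "\<And>x c A lev l. elimination_run K M T E x c A lev \<Longrightarrow>
      real (card (elimination_run.costly T x c A lev l)) \<le> D * 2 ^ l"
  shows "(\<Sum>t<T. (MAX a\<in>{1..K}. \<mu> (ctx t, a)) - \<mu> (ctx t, arm r t))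
    \<le> real (Suc (floor_log T)) * (4 * sqrt (real T * D * L))"
proof -
  define A where "A = (\<lambda>t i. active L K E i (hist r t) (raw r))"
  define lay where "lay = (\<lambda>t. layer E (hist r t))"
  interpret elimination_run K M T E "arm r" ctx A lay
    unfolding A_def lay_def by (rule elimination_run_of_accurate(1)[OF acc])
  define gap where "gap = (\<lambda>t. (MAX a\<in>{1..K}. \<mu> (ctx t, a)) - \<mu> (ctx t, arm r t))"
  have layered: "\<exists>l\<le>floor_log T. t \<in> rounds l" if t: "t < T" for t
  proof -
    obtain u where u: "u \<in> U t" using U_nonempty[OF t] by blast
    have "card {s. s < t \<and> (arm r s, u) \<in> E} \<le> card {..<t}" by (intro card_mono) auto
    then have "lay t u \<le> floor_log T"
      unfolding lay_def layer_def obs_count_hist using t by (intro floor_log_le_iff) simp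
    moreover have "t \<in> rounds (lay t u)"
    proof -
      have "lay t a = lay t u" if "a \<in> U t" for a
        by (rule antisym) (use u that in \<open>simp_all add: U_def least_level_def\<close>)
      then show ?thesis using t by (simp add: rounds_def)
    qed
    ultimately show ?thesis by blast
  qed
  have gap_le: "gap t \<le> (if A t (ctx t) = {arm r t} then 0 else 4 * sqrt (L / 2 ^ l))"
    if t: "t \<in> rounds l" for t l
  proof -
    have tT: "t < T" using t by (simp add: rounds_def)
    have "Max ((\<lambda>a. \<mu> (ctx t, a)) ` {1..K}) \<in> (\<lambda>a. \<mu> (ctx t, a)) ` {1..K}"
      using K by (intro Max_in) auto
    then obtain b where b: "b \<in> {1..K}" "Max ((\<lambda>a. \<mu> (ctx t, a)) ` {1..K}) = \<mu> (ctx t, b)" by auto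
    have "\<forall>i\<in>{1..K}. \<mu> (ctx t, i) \<le> \<mu> (ctx t, b)"
      unfolding b(2)[symmetric] by (auto intro!: Max_ge)
    then have bA: "b \<in> A t (ctx t)"
      unfolding A_def using elimination_run_of_accurate(2)[OF acc tT b(1)] by simp
    obtain u where u: "u \<in> U t" using U_nonempty[OF tT] by blast
    have lev: "l \<le> lay t i" if "i \<in> A t (ctx t)" for i
      using u t that by (auto simp: rounds_def U_def least_level_def)
    have aA: "arm r t \<in> A t (ctx t)" by (rule played_active[OF tT])
    have "gap t = \<mu> (ctx t, b) - \<mu> (ctx t, arm r t)" by (simp only: gap_def b(2))
    moreover have "\<mu> (ctx t, b) - \<mu> (ctx t, arm r t) \<le> 4 * sqrt (L / 2 ^ l)"
      using aA bA lev unfolding A_def lay_def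
      by (intro gap_le_of_active[OF acc tT _ b(1)]) auto
    ultimately show ?thesis using bA by auto
  qed
  have "(\<Sum>t<T. gap t) \<le> (\<Sum>t<T. \<Sum>l\<in>{l \<in> {..floor_log T}. t \<in> costly l}. 4 * sqrt (L / 2 ^ l))"
  proof (rule sum_mono)
    fix t assume "t \<in> {..<T}"
    then obtain l where l: "l \<le> floor_log T" "t \<in> rounds l" using layered by blast
    have nn: "0 \<le> (\<Sum>l\<in>{l \<in> {..floor_log T}. t \<in> costly l}. 4 * sqrt (L / 2 ^ l))"
      using L by (intro sum_nonneg) auto
    show "gap t \<le> (\<Sum>l\<in>{l \<in> {..floor_log T}. t \<in> costly l}. 4 * sqrt (L / 2 ^ l))"
    proof (cases "A t (ctx t) = {arm r t}")
      case True
      then show ?thesis using gap_le[OF l(2)] nn by simp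
    next
      case False
      have "4 * sqrt (L / 2 ^ l) \<le> (\<Sum>l\<in>{l \<in> {..floor_log T}. t \<in> costly l}. 4 * sqrt (L / 2 ^ l))"
        by (rule member_le_sum) (use L l False in \<open>auto simp: costly_def\<close>)
      then show ?thesis using gap_le[OF l(2)] False by simp
    qed
  qed
  also have "\<dots> = (\<Sum>l\<le>floor_log T. \<Sum>t\<in>{t \<in> {..<T}. t \<in> costly l}. 4 * sqrt (L / 2 ^ l))"
    by (rule sum.swap_restrict) auto
  also have "\<dots> = (\<Sum>l\<le>floor_log T. real (card (costly l)) * (4 * sqrt (L / 2 ^ l)))"
  proof (rule sum.cong[OF refl])
    fix l
    have "{t \<in> {..<T}. t \<in> costly l} = costly l" by (auto simp: costly_def rounds_def)
    then show "(\<Sum>t\<in>{t \<in> {..<T}. t \<in> costly l}. 4 * sqrt (L / 2 ^ l)) = real (card (costly l)) * (4 * sqrt (L / 2 ^ l))"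
      by simp
  qed
  also have "\<dots> \<le> (\<Sum>l\<le>floor_log T. 4 * sqrt (real T * D * L))"
  proof (rule sum_mono)
    fix l
    let ?n = "real (card (costly l))"
    have nT: "?n \<le> real T"
    proof -
      have "card (costly l) \<le> card {..<T}" by (intro card_mono) (auto simp: costly_def rounds_def)
      then show ?thesis by simp
    qed
    have nD: "?n \<le> D * 2 ^ l" by (rule costly) unfold_locales
    \<comment> \<open>Of the two copies of \<open>?n\<close> under the root, one is bounded by
      \<open>T\<close> and the other by \<open>D * 2 ^ l\<close>. The layer cancels, so every layer
      costs the same.\<close>
    have "?n * sqrt (L / 2 ^ l) = sqrt (?n * ?n * (L / 2 ^ l))"
      by (simp add: real_sqrt_mult real_sqrt_divide)
    also have "\<dots> \<le> sqrt (real T * (D * 2 ^ l) * (L / 2 ^ l))"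
      using nT nD L D by (intro real_sqrt_le_mono mult_right_mono mult_mono) auto
    also have "\<dots> = sqrt (real T * D * L)" by simp
    finally show "?n * (4 * sqrt (L / 2 ^ l)) \<le> 4 * sqrt (real T * D * L)" by simp
  qed
  also have "\<dots> = real (Suc (floor_log T)) * (4 * sqrt (real T * D * L))" by simp
  finally show ?thesis by (simp only: gap_def)
qed

lemma expected_regret_le:
  assumes env: "(\<mu>, P) \<in> environments M K T" and D: "D \<ge> 0"
    and costly: "\<And>x c A lev l. elimination_run K M T E x c A lev \<Longrightarrow>
      real (card (elimination_run.costly T x c A lev l)) \<le> D * 2 ^ l"
  shows "expected_regret T K M E (elimination_policy L K E) ctx \<mu> P
    \<le> real (Suc (floor_log T)) * (4 * sqrt (real T * D * L))
       + real T * (real (T * T * M * K) * (2 * exp (- L)))"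
proof -
  have P: "prob_space P" using env by (auto simp: environments_def)
  interpret prob_space P by (rule P)
  obtain B where B: "B \<in> sets P" "{r \<in> space P. \<not> accurate \<mu> r} \<subseteq> B"
    "measure P B \<le> real (T * T * M * K) * (2 * exp (- L))"
    using prob_inaccurate[OF env] by blast
  let ?R = "real (Suc (floor_log T)) * (4 * sqrt (real T * D * L))"
  let ?gaps = "\<lambda>r. \<Sum>t<T. (MAX a\<in>{1..K}. \<mu> (ctx t, a)) - \<mu> (ctx t, arm r t)"
  have R0: "0 \<le> ?R" using D L by (intro mult_nonneg_nonneg) auto
  have eq: "measure_pmf.expectation (play M K E (elimination_policy L K E) ctx r T)
      (\<lambda>as. \<Sum>t<T. (MAX a\<in>{1..K}. \<mu> (ctx t, a)) - \<mu> (ctx t, as ! t)) = ?gaps r" for r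
    by (simp add: play_eq nth_hist)
  have mu01: "\<mu> (ctx t, a) \<in> {0..1}" if t: "t < T" and a: "a \<in> {1..K}" for t a
  proof -
    have ae: "AE r in P. r t (ctx t, a) \<in> {0..1}" and mean: "(\<integral>r. r t (ctx t, a) \<partial>P) = \<mu> (ctx t, a)"
      using env t a ctx[OF t] by (auto simp: environments_def)
    have "0 \<le> (\<integral>r. r t (ctx t, a) \<partial>P)"
      using ae by (intro integral_nonneg_AE) (auto elim: eventually_mono)
    moreover have "(\<integral>r. r t (ctx t, a) \<partial>P) \<le> (\<integral>r. 1 \<partial>P)"
      using ae by (intro integral_mono_AE') (auto elim: eventually_mono)
    ultimately show ?thesis by (simp add: mean prob_space)
  qed
  have gaps_T: "?gaps r \<le> real T" for r
  proof -
    have "?gaps r \<le> (\<Sum>t<T. 1)"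
    proof (rule sum_mono)
      fix t assume "t \<in> {..<T}"
      then have t: "t < T" by simp
      have "(MAX a\<in>{1..K}. \<mu> (ctx t, a)) \<le> 1"
        using K mu01[OF t] by (intro Max.boundedI) auto
      then show "(MAX a\<in>{1..K}. \<mu> (ctx t, a)) - \<mu> (ctx t, arm r t) \<le> 1"
        using mu01[OF t arm_in[of r t]] by simp
    qed
    then show ?thesis by simp
  qed
  have "expected_regret T K M E (elimination_policy L K E) ctx \<mu> P = (\<integral>r. ?gaps r \<partial>P)"
    by (simp only: expected_regret_def eq)
  \<comment> \<open>The nonnegativity of the dominating function covers the default value 0 of the
    integral should the left-hand integrand not be integrable.\<close>
  also have "\<dots> \<le> (\<integral>r. ?R + real T * indicator B r \<partial>P)"
  proof (rule integral_mono')
    show "integrable P (\<lambda>r. ?R + real T * indicator B r)"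
      using B(1) by (intro Bochner_Integration.integrable_add integrable_mult_right integrable_const integrable_indicator)
        (auto simp: emeasure_eq_measure)
    show "0 \<le> ?R + real T * indicator B r" for r
      using R0 by simp
    show "?gaps r \<le> ?R + real T * indicator B r" if "r \<in> space P" for r
    proof (cases "r \<in> B")
      case True
      then show ?thesis using gaps_T[of r] R0 by simp
    next
      case False
      then have "accurate \<mu> r" using B(2) that by blast
      then show ?thesis using regret_of_accurate[OF _ D costly] False by simp
    qed
  qed
  also have "\<dots> = ?R + real T * measure P B"
    using B(1) by (subst Bochner_Integration.integral_add) (auto simp: prob_space emeasure_eq_measure)
  also have "\<dots> \<le> ?R + real T * (real (T * T * M * K) * (2 * exp (- L)))"
    using B(3) by (intro add_left_mono mult_left_mono) auto
  finally show ?thesis .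
qed

end

section \<open>Choice of the confidence level and the final constants\<close>

text \<open>The factor 3 makes exp(-L) equal to exp(-3) / (KMT)^3, which outweighs the total failure
  cost of order T^3 M K; the summand 1 ensures \<open>L \<ge> 1\<close>, and exp(-3) absorbs the 2
  of the two-sided tail.\<close>

definition confidence :: "nat \<Rightarrow> nat \<Rightarrow> nat \<Rightarrow> real" where
  "confidence T K M = 3 * (1 + ln (real K * real M * real T))"

lemma regret_elimination_policy_le:
  assumes K: "K \<ge> 1" and M: "M \<ge> 1" and T: "T \<ge> 1" and E: "E \<subseteq> {1..K} \<times> {1..K}"
    and so: "strongly_observable K E" and b: "b \<ge> 1"
    and costly: "\<And>x c A lev l. elimination_run K M T E x c A lev \<Longrightarrow>
      card (elimination_run.costly T x c A lev l) \<le> 14 * Suc (floor_log K) * 2 ^ l * b"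
  shows "regret T K M E (elimination_policy (confidence T K M) K E)
    \<le> ereal (81 * (1 + ln (real K * real M * real T)) ^ 2 * sqrt (real b * real T))"
proof -
  define L where "L = confidence T K M"
  define z where "z = 1 + ln (real K * real M * real T)"
  define D where "D = 14 * real (Suc (floor_log K)) * real b"
  have prod_ge: "1 \<le> real K * real M * real T" "real K \<le> real K * real M * real T"
    "real T \<le> real K * real M * real T"
  proof -
    have "1 \<le> K * M * T" "K \<le> K * M * T" "T \<le> K * M * T"
      using K M T by simp_all
    then have "real 1 \<le> real (K * M * T)" "real K \<le> real (K * M * T)" "real T \<le> real (K * M * T)"
      by (blast intro: of_nat_mono)+
    then show "1 \<le> real K * real M * real T" "real K \<le> real K * real M * real T"
      "real T \<le> real K * real M * real T" by simp_all
  qed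
  have lnK: "ln (real K) \<le> z - 1" and lnT: "ln (real T) \<le> z - 1"
    unfolding z_def using prod_ge K T by (simp_all add: ln_le_cancel_iff)
  have z: "z \<ge> 1" using prod_ge(1) by (simp add: z_def)
  have Lz: "L = 3 * z" by (simp add: L_def confidence_def z_def)
  have fT: "real (Suc (floor_log T)) \<le> 2 * z" and fK: "real (Suc (floor_log K)) \<le> 2 * z"
    using floor_log_le_ln[OF T] floor_log_le_ln[OF K] lnT lnK z by simp_all
  have bT: "1 \<le> real b * real T"
    using mult_mono[of 1 "real b" 1 "real T"] b T by simp
  have D0: "D \<ge> 0" by (simp add: D_def)
  have tail: "real T * (real (T * T * M * K) * (2 * exp (- L))) \<le> 1"
  proof -
    let ?X = "real K * real M * real T"
    have "exp (- L) = exp (- 3) / ?X ^ 3"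
    proof -
      have "exp L = exp 3 * exp (ln ?X) ^ 3"
        unfolding Lz z_def exp_of_nat_mult[symmetric] mult_exp_exp by (simp add: algebra_simps)
      also have "exp (ln ?X) = ?X" using prod_ge(1) by (intro exp_ln) linarith
      finally show ?thesis by (simp add: exp_minus field_simps)
    qed
    moreover have "2 * exp (- 3 :: real) \<le> 1"
      using exp_ge_add_one_self[of "3::real"] by (simp add: exp_minus field_simps)
    moreover have "real T * real (T * T * M * K) \<le> ?X ^ 3"
    proof -
      have "T * (T * T * M * K) \<le> (K * M * T) ^ 3"
        using mult_le_mono[of "M * K * 1" "M * K * (M * K * (M * K))" "T * T * T" "T * T * T"] K M
        by (simp add: power3_eq_cube ac_simps)
      then have "real (T * (T * T * M * K)) \<le> real ((K * M * T) ^ 3)" by (rule of_nat_mono)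
      then show ?thesis by simp
    qed
    moreover have "?X ^ 3 > 0" using prod_ge(1) by simp
    ultimately have "real T * real (T * T * M * K) * (2 * exp (- 3)) \<le> ?X ^ 3 * 1"
      by (intro mult_mono) auto
    then show ?thesis
      using \<open>exp (- L) = exp (- 3) / ?X ^ 3\<close> \<open>?X ^ 3 > 0\<close> by (simp add: field_simps)
  qed
  have main: "real (Suc (floor_log T)) * (4 * sqrt (real T * D * L)) \<le> 80 * z ^ 2 * sqrt (real b * real T)"
  proof -
    \<comment> \<open>Numerically 14 * 3 * 2 = 84 \<le> 10^2; the factors 2, 4 and 10 then multiply
      to 80.\<close>
    have "real T * D * L = (14 * 3 * z * real (Suc (floor_log K))) * (real b * real T)"
      by (simp add: D_def Lz)
    also have "\<dots> \<le> (14 * 3 * z * (2 * z)) * (real b * real T)"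
      using fK z by (intro mult_right_mono mult_left_mono) auto
    also have "\<dots> \<le> (10 * z)\<^sup>2 * (real b * real T)"
      using z by (intro mult_right_mono) (auto simp: power2_eq_square)
    finally have "sqrt (real T * D * L) \<le> sqrt ((10 * z)\<^sup>2 * (real b * real T))"
      by (rule real_sqrt_le_mono)
    also have "\<dots> = 10 * z * sqrt (real b * real T)"
      using z by (simp add: real_sqrt_mult)
    finally have s: "sqrt (real T * D * L) \<le> 10 * z * sqrt (real b * real T)" .
    have "real (Suc (floor_log T)) * (4 * sqrt (real T * D * L))
      \<le> (2 * z) * (4 * (10 * z * sqrt (real b * real T)))"
      using fT s z D0 by (intro mult_mono) (auto simp: Lz)
    then show ?thesis by (simp add: power2_eq_square)
  qed
  \<comment> \<open>Turns the failure cost, at most 1, into one more multiple of the main term: 80 +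
    1 = 81.\<close>
  have "1 * 1 \<le> z ^ 2 * sqrt (real b * real T)"
    using z bT by (intro mult_mono) (auto simp: one_le_power)
  then have total: "real (Suc (floor_log T)) * (4 * sqrt (real T * D * L))
      + real T * (real (T * T * M * K) * (2 * exp (- L))) \<le> 81 * z ^ 2 * sqrt (real b * real T)"
    using main tail by simp
  have "expected_regret T K M E (elimination_policy L K E) ctx \<mu> P \<le> 81 * z ^ 2 * sqrt (real b * real T)"
    if ctx: "ctx \<in> {..<T} \<rightarrow>\<^sub>E {1..M}" and env: "(\<mu>, P) \<in> environments M K T" for ctx \<mu> P
  proof -
    interpret bandit K M T E L ctx
      by unfold_locales (use K E so z ctx Lz in auto)
    have "real (card (elimination_run.costly T x c A lev l)) \<le> D * 2 ^ l"
      if "elimination_run K M T E x c A lev" for x c A lev l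
    proof -
      have "real (card (elimination_run.costly T x c A lev l)) \<le> real (14 * Suc (floor_log K) * 2 ^ l * b)"
        using costly[OF that] by (rule of_nat_mono)
      also have "\<dots> = D * 2 ^ l" by (simp add: D_def)
      finally show ?thesis .
    qed
    from expected_regret_le[OF env D0 this] total show ?thesis by linarith
  qed
  then show ?thesis
    unfolding regret_def L_def[symmetric] z_def[symmetric]
    by (intro SUP_least) (auto intro!: SUP_least)
qed

text \<open>The policy involves no graph parameter, so the same one serves every case; only the
  count of costly rounds differs.\<close>

theorem corollary2:
  shows "\<exists>(\<pi> :: nat \<Rightarrow> nat \<Rightarrow> nat \<Rightarrow> (nat \<times> nat) set \<Rightarrow> policy) (C :: real) (p :: nat).
    \<forall>(K::nat) (M::nat) (T::nat) (E :: (nat \<times> nat) set).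
      K \<ge> 1 \<longrightarrow> M \<ge> 1 \<longrightarrow> T \<ge> 1 \<longrightarrow> E \<subseteq> {1..K} \<times> {1..K} \<longrightarrow> strongly_observable K E \<longrightarrow>
        is_policy T K M E (\<pi> T K M E) \<and>
        regret T K M E (\<pi> T K M E)
          \<le> ereal (C * (1 + ln (real K * real M * real T)) ^ p *
                   sqrt (real (min (beta_bar M K E) (mas_number K E)) * real T)) \<and>
        (sym E \<or> trans E \<longrightarrow>
          regret T K M E (\<pi> T K M E)
            \<le> ereal (C * (1 + ln (real K * real M * real T)) ^ p *
                     sqrt (real (beta M K E) * real T)))"
proof (rule exI[of _ "\<lambda>T K M E. elimination_policy (confidence T K M) K E"], rule exI[of _ 81],
    rule exI[of _ 2], intro allI impI conjI)
  fix K M T :: nat and E :: "(nat \<times> nat) set"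
  assume A: "K \<ge> 1" "M \<ge> 1" "T \<ge> 1" "E \<subseteq> {1..K} \<times> {1..K}" "strongly_observable K E"
  show "is_policy T K M E (elimination_policy (confidence T K M) K E)"
    by (rule elimination_policy_is_policy[OF A(1)])
  have "beta_bar M K E \<ge> 1"
    using beta_pos[OF A(1,2)] beta_le_beta_bar order_trans by blast
  then have "min (beta_bar M K E) (mas_number K E) \<ge> 1"
    using mas_pos[OF A(1)] by simp
  then show "regret T K M E (elimination_policy (confidence T K M) K E)
      \<le> ereal (81 * (1 + ln (real K * real M * real T)) ^ 2 *
          sqrt (real (min (beta_bar M K E) (mas_number K E)) * real T))"
    by (rule regret_elimination_policy_le[OF A]) (rule elimination_run.card_costly_le(1)[OF _ A(1,2)])
  show "regret T K M E (elimination_policy (confidence T K M) K E)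
      \<le> ereal (81 * (1 + ln (real K * real M * real T)) ^ 2 * sqrt (real (beta M K E) * real T))"
    if "sym E \<or> trans E"
    by (rule regret_elimination_policy_le[OF A beta_pos[OF A(1,2)]])
      (rule elimination_run.card_costly_le(2)[OF _ A(1,2) that])
qed

end
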